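(* Let $\Delta$ be a pure simplicial complex of dimension $d-1$ with $d\geq 1$, let $k$ be a field, and let $\mathfrak m$ be the maximal homogeneous ideal of the face ring $k[\Delta]$. Then $$\overline e_1(\mathfrak m)=e_1(\mathfrak m)\ge 0.$$
   Context: $\Delta$ is a finite simplicial complex on vertices $v_1,\dots,v_s$; it is pure if all its facets (maximal faces) have the same dimension. The face ring is $k[\Delta]=k[x_1,\dots,x_s]/I_\Delta$, where $I_\Delta$ is generated by the square-free monomials $x_{a_1}\cdots x_{a_m}$ with $1\le a_1<\cdots<a_m\le s$ and $\{v_{a_1},\dots,v_{a_m}\}\notin\Delta$. The maximal homogeneous ideal $\mathfrak m$ is generated by the images of $x_1,\dots,x_s$. For an ideal $K$ of a ring, $\overline K$ denotes its integral closure. $\lambda$ denotes length. The functions $n\mapsto\lambda(k[\Delta]/\mathfrak m^{n+1})$ and $n\mapsto\lambda(k[\Delta]/\overline{\mathfrak m^{n+1}})$ agree for $n\gg0$ with polynomials $P$ and $\overline P$ of degree $d=\dim k[\Delta]$. Writing a polynomial $Q$ of degree $d$ as $Q=\sum_{i=0}^d(-1)^ie_i(Q)\binom{X+d-i}{d-i}$, one sets $e_1(\mathfrak m)=e_1(P)$ and $\overline e_1(\mathfrak m)=e_1(\overline P)$. *)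

theory Defs
  imports
    "HOL-Library.Poly_Mapping"
    "HOL-Library.Extended_Nat"
    "HOL-Computational_Algebra.Polynomial"
    "HOL-Algebra.Module"
    "HOL-Algebra.QuotRing"
    "HOL-Algebra.Ideal_Product"
    "HOL-Algebra.Algebraic_Closure_Type"
begin

section \<open>Simplicial complexes\<close>

text \<open>The vertices are the elements of a finite type; a vertex is not required to be a face,
  so that the definition covers both usual conventions. A complex contains the empty face.\<close>

definition simplicial_complex :: "'v::finite set set \<Rightarrow> bool" where
  "simplicial_complex \<Delta> \<longleftrightarrow> \<Delta> \<noteq> {} \<and> (\<forall>F\<in>\<Delta>. \<forall>G. G \<subseteq> F \<longrightarrow> G \<in> \<Delta>)"

definition face_dim :: "'v set \<Rightarrow> int" where
  "face_dim F = int (card F) - 1"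

definition complex_dim :: "'v::finite set set \<Rightarrow> int" where
  "complex_dim \<Delta> = Max (face_dim ` \<Delta>)"

definition facets :: "'v set set \<Rightarrow> 'v set set" where
  "facets \<Delta> = {F \<in> \<Delta>. \<forall>G\<in>\<Delta>. F \<subseteq> G \<longrightarrow> F = G}"

definition pure_complex :: "'v set set \<Rightarrow> bool" where
  "pure_complex \<Delta> \<longleftrightarrow> (\<forall>F\<in>facets \<Delta>. \<forall>G\<in>facets \<Delta>. face_dim F = face_dim G)"


section \<open>Face rings\<close>

text \<open>Polynomials over \<open>'k\<close> in variables indexed by \<open>'v\<close>: finitely supported
  coefficient functions on exponent vectors, with the convolution product of
  \<^theory>\<open>HOL-Library.Poly_Mapping\<close>.\<close>

type_synonym ('v, 'k) mpoly = "('v \<Rightarrow>\<^sub>0 nat) \<Rightarrow>\<^sub>0 'k"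

abbreviation mpoly_ring :: "('v, 'k::field) mpoly ring" where
  "mpoly_ring \<equiv> ring_of_type_algebra"

definition var :: "'v \<Rightarrow> ('v, 'k::field) mpoly" where
  "var v = Poly_Mapping.single (Poly_Mapping.single v 1) 1"

definition stanley_reisner_ideal :: "'v::finite set set \<Rightarrow> ('v, 'k::field) mpoly set" where
  "stanley_reisner_ideal \<Delta> = genideal mpoly_ring {\<Prod>v\<in>A. var v |A. A \<notin> \<Delta>}"

definition face_ring :: "'v::finite set set \<Rightarrow> ('v, 'k::field) mpoly set ring" where
  "face_ring \<Delta> = mpoly_ring Quot stanley_reisner_ideal \<Delta>"

definition max_homogeneous_ideal :: "'v::finite set set \<Rightarrow> ('v, 'k::field) mpoly set set" where
  "max_homogeneous_ideal \<Delta> =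
     genideal (face_ring \<Delta>) {stanley_reisner_ideal \<Delta> +>\<^bsub>mpoly_ring\<^esub> var v |v. True}"


section \<open>Powers and integral closures of ideals\<close>

abbreviation ideal_power :: "('a, 'b) ring_scheme \<Rightarrow> 'a set \<Rightarrow> nat \<Rightarrow> 'a set" where
  "ideal_power R K n \<equiv> K [^]\<^bsub>ideals_set R\<^esub> n"

text \<open>\<open>x\<close> is integral over \<open>K\<close> if
  \<open>x\<^sup>n + a\<^sub>1 x\<^sup>n\<^sup>-\<^sup>1 + \<dots> + a\<^sub>n = 0\<close> for some \<open>n \<ge> 1\<close> and \<open>a\<^sub>i \<in> K\<^sup>i\<close>.\<close>

definition ideal_integral_closure :: "('a, 'b) ring_scheme \<Rightarrow> 'a set \<Rightarrow> 'a set" where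
  "ideal_integral_closure R K =
     {x \<in> carrier R. \<exists>n a. n \<ge> 1 \<and> a 0 = \<one>\<^bsub>R\<^esub> \<and> (\<forall>i\<in>{1..n}. a i \<in> ideal_power R K i) \<and>
        (\<Oplus>\<^bsub>R\<^esub>i\<in>{..n}. a i \<otimes>\<^bsub>R\<^esub> x [^]\<^bsub>R\<^esub> (n - i)) = \<zero>\<^bsub>R\<^esub>}"


section \<open>Length\<close>

text \<open>The length of a module is the supremum of the \<open>n\<close> for which there is a chain
  \<open>N\<^sub>0 \<subset> N\<^sub>1 \<subset> \<dots> \<subset> N\<^sub>n\<close> of submodules.\<close>

definition module_length :: "('a, 'b) ring_scheme \<Rightarrow> ('a, 'c, 'd) module_scheme \<Rightarrow> enat" where
  "module_length R M =
     Sup {enat n |n. \<exists>N. (\<forall>i\<le>n. submodule (N i) R M) \<and> (\<forall>i<n. N i \<subset> N (Suc i))}"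

definition quotient_module :: "'a ring \<Rightarrow> 'a set \<Rightarrow> ('a, 'a set) module" where
  "quotient_module R K =
     ring.extend (R Quot K) \<lparr>module.smult = (\<lambda>r C. (K +>\<^bsub>R\<^esub> r) \<otimes>\<^bsub>R Quot K\<^esub> C)\<rparr>"

abbreviation quotient_length :: "'a ring \<Rightarrow> 'a set \<Rightarrow> enat" where
  "quotient_length R K \<equiv> module_length R (quotient_module R K)"


section \<open>Hilbert polynomials and Hilbert coefficients\<close>

definition eventual_poly :: "(nat \<Rightarrow> enat) \<Rightarrow> rat poly" where
  "eventual_poly h =
     (THE P. \<forall>\<^sub>F n in sequentially. \<exists>l. h n = enat l \<and> poly P (of_nat n) = of_nat l)"

text \<open>The \<open>i\<close>-th coefficient, for \<open>i \<le> D = degree Q\<close>, in the unique expansion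
  \<open>Q = \<Sum>\<^sub>j (-1)\<^sup>j e\<^sub>j binom(X + D - j, D - j)\<close>.\<close>

definition binomial_basis_coeff :: "rat poly \<Rightarrow> nat \<Rightarrow> rat" where
  "binomial_basis_coeff Q i =
     (THE c. \<exists>e. e i = c \<and>
        (\<forall>x. poly Q x = (\<Sum>j\<le>degree Q. (-1) ^ j * e j *
               ((x + of_nat (degree Q - j)) gchoose (degree Q - j)))))"

definition hilbert_coeff :: "'a ring \<Rightarrow> 'a set \<Rightarrow> nat \<Rightarrow> rat" where
  "hilbert_coeff R I =
     binomial_basis_coeff (eventual_poly (\<lambda>n. quotient_length R (ideal_power R I (n + 1))))"

definition normal_hilbert_coeff :: "'a ring \<Rightarrow> 'a set \<Rightarrow> nat \<Rightarrow> rat" where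
  "normal_hilbert_coeff R I =
     binomial_basis_coeff (eventual_poly
       (\<lambda>n. quotient_length R (ideal_integral_closure R (ideal_power R I (n + 1)))))"

end

theory Submission
  imports Defs
begin

text \<open>
  The powers of the maximal homogeneous ideal are already integrally closed, so both Hilbert
  functions coincide. Indeed \<open>k[\<Delta>]\<close> is graded and reduced: if \<open>x\<close> has a nonzero component in its lowest
  degree \<open>r < n\<close>, then \<open>x\<^sup>N\<close> has one in degree \<open>r N\<close>, whereas the terms \<open>a\<^sub>i x\<^sup>N\<^sup>-\<^sup>i\<close> with
  \<open>i \<ge> 1\<close> of an equation of integral dependence over \<open>\<mm>\<^sup>n\<close> live in degrees at least
  \<open>n i + r (N - i) > r N\<close>.

  The length of \<open>k[\<Delta>]/\<mm>\<^sup>n\<^sup>+\<^sup>1\<close> is the number of monomials of degree at most \<open>n\<close> supported on a face,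
  that is \<open>\<Sum>\<^sub>F binom(n, |F|)\<close>. Rewriting this in the basis \<open>binom(n + m, m)\<close> gives
  \<open>e\<^sub>1 = d f\<^sub>d\<^sub>-\<^sub>1 - f\<^sub>d\<^sub>-\<^sub>2\<close>, where \<open>f\<^sub>i\<close> counts the \<open>i\<close>-dimensional faces. This is nonnegative because
  by purity every \<open>(d-2)\<close>-dimensional face arises by deleting a vertex from one of the facets,
  each of which has \<open>d\<close> vertices.
\<close>

section \<open>Monomial subspaces of the polynomial ring\<close>

abbreviation lookup :: "('a \<Rightarrow>\<^sub>0 'b::zero) \<Rightarrow> 'a \<Rightarrow> 'b" where
  "lookup \<equiv> Poly_Mapping.lookup"

abbreviation keys :: "('a \<Rightarrow>\<^sub>0 'b::zero) \<Rightarrow> 'a set" where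
  "keys \<equiv> Poly_Mapping.keys"

text \<open>A polynomial is the finite sum of its terms. This reduces membership in ideals, and in
  preimages of ideals, to single monomials with a coefficient.\<close>

lemma mpoly_mem_of_monomials:
  fixes p :: "'a \<Rightarrow>\<^sub>0 'b::comm_monoid_add"
  assumes "0 \<in> T" and "\<And>p q. p \<in> T \<Longrightarrow> q \<in> T \<Longrightarrow> p + q \<in> T"
    and "\<And>m. m \<in> keys p \<Longrightarrow> Poly_Mapping.single m (lookup p m) \<in> T"
  shows "p \<in> T"
proof -
  let ?s = "\<lambda>M. \<Sum>m\<in>M. Poly_Mapping.single m (lookup p m)"
  have "?s M \<in> T" if "finite M" "M \<subseteq> keys p" for M
    using that by (induction M) (auto simp: assms)
  moreover have "lookup (?s (keys p)) k = lookup p k" for k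
    by (cases "k \<in> keys p") (auto simp: lookup_sum lookup_single when_def in_keys_iff)
  then have "p = ?s (keys p)"
    by (intro poly_mapping_eqI) metis
  ultimately show ?thesis by (metis finite_keys order_refl)
qed

lemma lookup_const_times:
  fixes p :: "'a::comm_monoid_add \<Rightarrow>\<^sub>0 'b::comm_semiring_1"
  shows "lookup (Poly_Mapping.single 0 c * p) m = c * lookup p m"
  by (simp flip: mult_map_scale_conv_mult add: Poly_Mapping.map.rep_eq when_def)

lemma keys_plus_nat: "keys (a + b) = keys a \<union> keys b" for a b :: "'v \<Rightarrow>\<^sub>0 nat"
  by (auto simp: in_keys_iff lookup_add)

definition total_degree :: "('v::finite \<Rightarrow>\<^sub>0 nat) \<Rightarrow> nat" where
  "total_degree m = (\<Sum>v\<in>UNIV. lookup m v)"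

lemma total_degree_add [simp]: "total_degree (a + b) = total_degree a + total_degree b"
  by (simp add: total_degree_def lookup_add sum.distrib)

lemma total_degree_0 [simp]: "total_degree 0 = 0"
  by (simp add: total_degree_def)

lemma total_degree_single [simp]: "total_degree (Poly_Mapping.single v n) = n"
  by (simp add: total_degree_def lookup_single when_def)

lemma total_degree_eq_0_iff [simp]: "total_degree m = 0 \<longleftrightarrow> m = 0"
  by (auto simp: total_degree_def intro!: poly_mapping_eqI)

lemma lookup_le_total_degree: "lookup m v \<le> total_degree m"
  unfolding total_degree_def by (rule member_le_sum) auto

text \<open>Monomial ideals are described by the set \<open>E\<close> of exponents of the monomials outside of them;
  the monomials in \<open>E\<close> form a basis of the quotient.\<close>

definition avoiding :: "'a set \<Rightarrow> ('a \<Rightarrow>\<^sub>0 'b::zero) set" where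
  "avoiding E = {p. keys p \<inter> E = {}}"

lemma avoiding_iff: "p \<in> avoiding E \<longleftrightarrow> (\<forall>m\<in>E. lookup p m = 0)"
  by (auto simp: avoiding_def in_keys_iff)

lemma avoiding_antimono: "E \<subseteq> E' \<Longrightarrow> avoiding E' \<subseteq> avoiding E"
  by (auto simp: avoiding_def)

lemma zero_avoiding [simp]: "0 \<in> avoiding E"
  by (simp add: avoiding_iff)

lemma add_avoiding: "p \<in> avoiding E \<Longrightarrow> q \<in> avoiding E \<Longrightarrow> p + q \<in> avoiding E"
  for p :: "'a \<Rightarrow>\<^sub>0 'b::comm_monoid_add"
  by (simp add: avoiding_iff lookup_add)

lemma uminus_avoiding: "p \<in> avoiding E \<Longrightarrow> - p \<in> avoiding E"
  for p :: "'a \<Rightarrow>\<^sub>0 'b::ab_group_add"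
  by (simp add: avoiding_iff)

lemma single_avoiding_iff: "Poly_Mapping.single m c \<in> avoiding E \<longleftrightarrow> m \<notin> E \<or> c = 0"
  by (auto simp: avoiding_iff lookup_single when_def)

text \<open>Exponents add when monomials multiply, so such an \<open>E\<close> is an order ideal for
  divisibility. This is what makes \<open>avoiding E\<close> absorb multiplication.\<close>

definition divisor_closed :: "'a::comm_monoid_add set \<Rightarrow> bool" where
  "divisor_closed E \<longleftrightarrow> (\<forall>a b. a + b \<in> E \<longrightarrow> a \<in> E)"

lemma mult_avoiding:
  fixes p q :: "'a::comm_monoid_add \<Rightarrow>\<^sub>0 'b::comm_ring_1"
  assumes "divisor_closed E" "p \<in> avoiding E"
  shows "q * p \<in> avoiding E"
proof -
  have "m \<notin> E" if m: "m \<in> keys (q * p)" for m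
  proof
    assume "m \<in> E"
    from m obtain a b where "m = b + a" "b \<in> keys p"
      using keys_mult[of q p] by (auto simp: add.commute)
    with \<open>m \<in> E\<close> assms show False
      by (auto simp: divisor_closed_def avoiding_def)
  qed
  then show ?thesis by (auto simp: avoiding_def)
qed

section \<open>Subspaces and their dimension modulo a cofinite monomial subspace\<close>

text \<open>Scalars act as constant polynomials, so an ideal is a subspace by its absorption
  property.\<close>

definition linear_subspace :: "('a::comm_monoid_add \<Rightarrow>\<^sub>0 'b::field) set \<Rightarrow> bool" where
  "linear_subspace L \<longleftrightarrow> 0 \<in> L \<and> (\<forall>p\<in>L. \<forall>q\<in>L. p + q \<in> L) \<and>
     (\<forall>c. \<forall>p\<in>L. Poly_Mapping.single 0 c * p \<in> L)"

text \<open>\<open>rk L\<close> is the dimension of \<open>L\<close> modulo \<open>avoiding B\<close>. It is built up by adding one monomial \<open>b\<close>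
  at a time, splitting \<open>L\<close> into the polynomials whose \<open>b\<close>-free part lies in \<open>L\<close> and the question whether \<open>b\<close> occurs in \<open>L\<close>.\<close>

lemma rank_function_exists:
  assumes "finite B"
  shows "\<exists>rk. \<forall>L::('a::comm_monoid_add \<Rightarrow>\<^sub>0 'b::field) set.
      linear_subspace L \<and> avoiding B \<subseteq> L \<longrightarrow>
      rk L \<le> card B \<and> (\<forall>L'. linear_subspace L' \<and> L \<subset> L' \<longrightarrow> rk L < (rk L' :: nat))"
  using assms
proof (induction B)
  case empty
  have "avoiding {} = (UNIV :: ('a \<Rightarrow>\<^sub>0 'b) set)"
    by (auto simp: avoiding_def)
  \<comment> \<open>Here \<open>L\<close> is the whole space, so nothing lies strictly above
    it.\<close>
  then show ?case
    by (intro exI[of _ "\<lambda>_. 0"]) auto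
next
  case (insert b B)
  from insert.IH obtain rk where rk: "\<And>L::('a \<Rightarrow>\<^sub>0 'b) set. linear_subspace L \<Longrightarrow> avoiding B \<subseteq> L \<Longrightarrow> rk L \<le> card B"
    "\<And>L L'::('a \<Rightarrow>\<^sub>0 'b) set. linear_subspace L \<Longrightarrow> avoiding B \<subseteq> L \<Longrightarrow> linear_subspace L' \<Longrightarrow> L \<subset> L' \<Longrightarrow> rk L < (rk L' :: nat)"
    by metis
  let ?cut = "\<lambda>p::'a \<Rightarrow>\<^sub>0 'b. p - Poly_Mapping.single b (lookup p b)"
  define hat where "hat L = {p. ?cut p \<in> L}" for L
  define pv where "pv L = (\<exists>p\<in>L. lookup p b \<noteq> 0)" for L :: "('a \<Rightarrow>\<^sub>0 'b) set"
  define rk' where "rk' L = rk (hat L) + of_bool (pv L)" for L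
  have cut_add: "?cut (p + q) = ?cut p + ?cut q" for p q
    by (simp add: lookup_add single_add)
  have cut_scale: "?cut (Poly_Mapping.single 0 c * p) = Poly_Mapping.single 0 c * ?cut p" for c p
    by (simp add: lookup_const_times right_diff_distrib mult_single)
  have hat_sub: "linear_subspace (hat L)" if "linear_subspace L" for L
    using that unfolding linear_subspace_def hat_def mem_Collect_eq Ball_def cut_add cut_scale
    by simp
  \<comment> \<open>Cutting \<open>b\<close> off a polynomial that avoids \<open>B\<close> makes it
    avoid \<open>insert b B\<close>; hence the induction hypothesis for \<open>B\<close> applies to
    \<open>hat L\<close>.\<close>
  have hat_avoid: "avoiding B \<subseteq> hat L" if "avoiding (insert b B) \<subseteq> L" for L
  proof
    fix p :: "'a \<Rightarrow>\<^sub>0 'b" assume "p \<in> avoiding B"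
    then have "?cut p \<in> avoiding (insert b B)"
      using insert.hyps by (auto simp: avoiding_iff lookup_minus lookup_single when_def)
    with that show "p \<in> hat L" by (auto simp: hat_def)
  qed
  have "rk' L < rk' L'" if L: "linear_subspace L" "avoiding (insert b B) \<subseteq> L"
    and L': "linear_subspace L'" and sub: "L \<subset> L'" for L L'
  proof -
    have hsub: "hat L \<subseteq> hat L'" and psub: "pv L \<Longrightarrow> pv L'"
      using sub by (auto simp: hat_def pv_def)
    show ?thesis
    proof (cases "hat L = hat L' \<and> (pv L' \<longrightarrow> pv L)")
      case False
      then consider "hat L \<subset> hat L'" | "hat L = hat L'" "pv L'" "\<not> pv L"
        using hsub by blast
      then show ?thesis
      proof cases
        case 1
        with rk(2)[OF hat_sub hat_avoid hat_sub] L L' have "rk (hat L) < rk (hat L')" by blast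
        then show ?thesis using psub by (auto simp: rk'_def)
      qed (auto simp: rk'_def)
    next
      case True
      obtain p where p: "p \<in> L'" "p \<notin> L" using sub by auto
      \<comment> \<open>If \<open>b\<close> occurs in \<open>p\<close>, it also occurs in some
        \<open>q\<close> of \<open>L\<close>, and a multiple of \<open>q\<close> cancels the
        \<open>b\<close>-coefficient of \<open>p\<close>. The result equals its own cut, so it
        separates \<open>hat L'\<close> from \<open>hat L\<close>, against the case
        assumption.\<close>
      have "\<exists>r\<in>L'. r \<notin> L \<and> lookup r b = 0"
      proof (cases "lookup p b = 0")
        case False
        with True p obtain q where q: "q \<in> L" "lookup q b \<noteq> 0"
          by (auto simp: pv_def)
        define c where "c = - (lookup p b / lookup q b)"
        let ?s = "Poly_Mapping.single 0 c * q"
        have s: "?s \<in> L" "- ?s \<in> L"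
        proof -
          have "Poly_Mapping.single 0 (-1) * ?s = - ?s"
            by (rule poly_mapping_eqI) (simp add: lookup_const_times)
          then show "?s \<in> L" "- ?s \<in> L" using q L(1) unfolding linear_subspace_def by metis+
        qed
        have "p + ?s \<in> L'" using s p L' sub by (auto simp: linear_subspace_def)
        moreover have "p + ?s \<notin> L"
        proof
          assume "p + ?s \<in> L"
          then have "(p + ?s) + - ?s \<in> L" using s L unfolding linear_subspace_def by blast
          then show False using p by simp
        qed
        moreover have "lookup (p + ?s) b = 0"
          using q by (simp add: lookup_add lookup_const_times c_def)
        ultimately show ?thesis by blast
      qed (use p in auto)
      then obtain r where r: "r \<in> L'" "r \<notin> L" "lookup r b = 0" by blast
      then have "r \<in> hat L'" "r \<notin> hat L" by (auto simp: hat_def)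
      with True show ?thesis by simp
    qed
  qed
  moreover have "rk' L \<le> card (insert b B)" if "linear_subspace L" "avoiding (insert b B) \<subseteq> L" for L
    using rk(1)[OF hat_sub hat_avoid] that insert.hyps by (auto simp: rk'_def of_bool_def le_SucI)
  ultimately show ?case by (intro exI[of _ rk']) blast
qed

text \<open>The upper bound for lengths: \<open>rk\<close> grows by at least one at each step and
  never exceeds \<open>card B\<close>.\<close>

lemma subspace_chain_length_le:
  fixes N :: "nat \<Rightarrow> ('a::comm_monoid_add \<Rightarrow>\<^sub>0 'b::field) set"
  assumes "finite B" and N: "\<And>i. i \<le> n \<Longrightarrow> linear_subspace (N i)" "\<And>i. i \<le> n \<Longrightarrow> avoiding B \<subseteq> N i"
    and strict: "\<And>i. i < n \<Longrightarrow> N i \<subset> N (Suc i)"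
  shows "n \<le> card B"
proof -
  obtain rk where rk: "\<And>L::('a \<Rightarrow>\<^sub>0 'b) set. linear_subspace L \<Longrightarrow> avoiding B \<subseteq> L \<Longrightarrow> rk L \<le> card B"
    "\<And>L L'::('a \<Rightarrow>\<^sub>0 'b) set. linear_subspace L \<Longrightarrow> avoiding B \<subseteq> L \<Longrightarrow> linear_subspace L' \<Longrightarrow> L \<subset> L' \<Longrightarrow> rk L < (rk L' :: nat)"
    using rank_function_exists[OF assms(1)] by metis
  have "i \<le> n \<Longrightarrow> i \<le> rk (N i)" for i
  proof (induction i)
    case (Suc i)
    then have "rk (N i) < rk (N (Suc i))" by (intro rk N strict) auto
    with Suc show ?case by simp
  qed simp
  with rk(1) N show ?thesis by (meson le_trans order_refl)
qed

section \<open>Chains of divisor-closed sets\<close>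

text \<open>An exponent of maximal total degree in \<open>B\<close> divides no other element of
  \<open>B\<close>.\<close>

lemma divisor_closed_remove_max:
  fixes B :: "('v::finite \<Rightarrow>\<^sub>0 nat) set"
  assumes "divisor_closed B" "finite B" "B \<noteq> {}"
  obtains b where "b \<in> B" "divisor_closed (B - {b})"
proof -
  obtain b where b: "b \<in> B" "\<And>a. a \<in> B \<Longrightarrow> total_degree a \<le> total_degree b"
  proof -
    have "Max (total_degree ` B) \<in> total_degree ` B"
      using assms by (intro Max_in) auto
    then obtain b where "b \<in> B" "total_degree b = Max (total_degree ` B)" by force
    with assms show thesis by (intro that[of b]) auto
  qed
  have "divisor_closed (B - {b})"
    unfolding divisor_closed_def
  proof (intro allI impI)
    fix a c assume ac: "a + c \<in> B - {b}"
    show "a \<in> B - {b}"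
      using ac assms(1) b(2)[of "a + c"] by (auto simp: divisor_closed_def)
  qed
  with b that show ?thesis by blast
qed

text \<open>The lower bound for lengths: peel off maximal exponents one at a time. Since
  \<open>avoiding\<close> reverses inclusions, the shrinking sets give a growing chain of monomial
  ideals.\<close>

lemma avoiding_chain_exists:
  fixes B :: "('v::finite \<Rightarrow>\<^sub>0 nat) set"
  assumes "finite B" "divisor_closed B"
  shows "\<exists>E. (\<forall>i. divisor_closed (E i) \<and> E i \<subseteq> B) \<and> E 0 = B \<and> (\<forall>i<card B. E (Suc i) \<subset> E i)"
  using assms
proof (induction "card B" arbitrary: B)
  case 0
  then show ?case by (intro exI[of _ "\<lambda>_. B"]) auto
next
  case (Suc n)
  then obtain b where b: "b \<in> B" "divisor_closed (B - {b})"
    by (metis divisor_closed_remove_max card.empty nat.distinct(1))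
  have "n = card (B - {b})" "finite (B - {b})"
    using b Suc by auto
  from Suc.hyps(1)[OF this(1) this(2) b(2)] obtain E where E: "\<forall>i. divisor_closed (E i) \<and> E i \<subseteq> B - {b}"
    "E 0 = B - {b}" "\<forall>i<n. E (Suc i) \<subset> E i"
    using \<open>n = card (B - {b})\<close> by auto
  show ?case
  proof (intro exI[of _ "\<lambda>i. case i of 0 \<Rightarrow> B | Suc j \<Rightarrow> E j"] conjI allI impI)
    fix i assume "i < card B"
    then show "(case Suc i of 0 \<Rightarrow> B | Suc j \<Rightarrow> E j) \<subset> (case i of 0 \<Rightarrow> B | Suc j \<Rightarrow> E j)"
      using E b Suc.hyps(2) by (auto split: nat.splits)
  qed (use E Suc in \<open>auto split: nat.splits\<close>)
qed

lemma avoiding_strict_antimono: "E \<subset> E' \<Longrightarrow> avoiding E' \<subset> (avoiding E :: ('a \<Rightarrow>\<^sub>0 'b::zero_neq_one) set)"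
proof -
  assume *: "E \<subset> E'"
  then obtain m where "m \<in> E'" "m \<notin> E" by blast
  then have "Poly_Mapping.single m 1 \<in> avoiding E" "Poly_Mapping.single m (1::'b) \<notin> avoiding E'"
    by (auto simp: single_avoiding_iff)
  with * show ?thesis using avoiding_antimono[of E E'] by blast
qed

section \<open>Ideals and lengths in quotient rings\<close>

lemma type_algebra_simps [simp]:
  "carrier (ring_of_type_algebra :: 'a::comm_ring_1 ring) = UNIV"
  "x \<otimes>\<^bsub>ring_of_type_algebra\<^esub> y = x * (y::'a)"
  "x \<oplus>\<^bsub>ring_of_type_algebra\<^esub> y = x + (y::'a)"
  "\<one>\<^bsub>ring_of_type_algebra\<^esub> = (1::'a)"
  "\<zero>\<^bsub>ring_of_type_algebra\<^esub> = (0::'a)"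
  by (simp_all add: ring_of_type_algebra_def)

lemma ring_type_algebra [simp]: "ring (ring_of_type_algebra :: 'a::comm_ring_1 ring)"
  and cring_type_algebra [simp]: "cring (ring_of_type_algebra :: 'a::comm_ring_1 ring)"
  by (rule ring_from_type_algebra cring_from_type_algebra)+

lemma type_algebra_a_inv [simp]: "\<ominus>\<^bsub>ring_of_type_algebra\<^esub> x = - (x::'a::comm_ring_1)"
proof -
  interpret ring "ring_of_type_algebra :: 'a ring" by simp
  show ?thesis using minus_equality[of "- x" x] by simp
qed

text \<open>Negatives arise as multiples by \<open>-1\<close>, and commutativity turns left
  multiples into right ones.\<close>

lemma ideal_type_algebra_iff:
  "ideal L ring_of_type_algebra \<longleftrightarrow>
     (0::'a::comm_ring_1) \<in> L \<and> (\<forall>x\<in>L. \<forall>y\<in>L. x + y \<in> L) \<and> (\<forall>r. \<forall>x\<in>L. r * x \<in> L)"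
  (is "_ \<longleftrightarrow> ?R")
proof
  assume "ideal L ring_of_type_algebra"
  then interpret L: ideal L "ring_of_type_algebra :: 'a ring" .
  show ?R
    using additive_subgroup.zero_closed[OF L.is_additive_subgroup]
      additive_subgroup.a_closed[OF L.is_additive_subgroup] L.I_l_closed by simp
next
  assume R: ?R
  show "ideal L ring_of_type_algebra"
  proof (rule idealI)
    have right: "x * r \<in> L" if "x \<in> L" for x r
      using R that by (metis mult.commute)
    have inv: "inv\<^bsub>add_monoid ring_of_type_algebra\<^esub> x = (-1) * x" for x :: 'a
      using type_algebra_a_inv[of x] by (simp add: a_inv_def)
    show "subgroup L (add_monoid ring_of_type_algebra)"
      using R unfolding subgroup_def inv by (simp del: mult_minus_left mult_minus1)
    show "x \<otimes>\<^bsub>ring_of_type_algebra\<^esub> a \<in> L" "a \<otimes>\<^bsub>ring_of_type_algebra\<^esub> x \<in> L" if "a \<in> L" for a x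
      using R right that by simp_all
  qed simp
qed

lemma ideal_avoiding:
  "divisor_closed E \<Longrightarrow> ideal (avoiding E :: ('v, 'k::field) mpoly set) mpoly_ring"
  by (simp add: ideal_type_algebra_iff add_avoiding mult_avoiding)

lemma divisor_closed_supports:
  assumes "simplicial_complex \<Delta>"
  shows "divisor_closed {m :: 'v::finite \<Rightarrow>\<^sub>0 nat. keys m \<in> \<Delta> \<and> total_degree m < n}"
    and "divisor_closed {m :: 'v \<Rightarrow>\<^sub>0 nat. keys m \<in> \<Delta>}"
  using assms unfolding divisor_closed_def simplicial_complex_def
  by (auto simp: keys_plus_nat)

text \<open>A monomial whose support is a nonface is divisible by the square-free generator of that
  nonface, whose exponent is \<open>e (keys m)\<close>.\<close>

lemma stanley_reisner_ideal_eq: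
  assumes "simplicial_complex (\<Delta> :: 'v::finite set set)"
  shows "stanley_reisner_ideal \<Delta> = (avoiding {m. keys m \<in> \<Delta>} :: ('v, 'k::field) mpoly set)"
    (is "_ = ?I")
proof -
  interpret ring "mpoly_ring :: ('v, 'k) mpoly ring" by simp
  define e :: "'v set \<Rightarrow> 'v \<Rightarrow>\<^sub>0 nat" where "e A = (\<Sum>v\<in>A. Poly_Mapping.single v 1)" for A
  let ?G = "{\<Prod>v\<in>A. var v |A. A \<notin> \<Delta>} :: ('v, 'k) mpoly set"
  have lookup_e: "lookup (e A) v = (if v \<in> A then 1 else 0)" for A v
    by (simp add: e_def lookup_sum lookup_single when_def)
  then have keys_e: "keys (e A) = A" for A
    by (auto simp: in_keys_iff split: if_splits)
  have prod_var: "(\<Prod>v\<in>A. var v) = Poly_Mapping.single (e A) (1::'k)" for A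
    using finite[of A] by (induction A) (simp_all add: e_def var_def mult_single)
  have idl: "ideal (stanley_reisner_ideal \<Delta> :: ('v, 'k) mpoly set) mpoly_ring"
    unfolding stanley_reisner_ideal_def by (rule genideal_ideal) simp
  have "stanley_reisner_ideal \<Delta> \<subseteq> ?I"
    unfolding stanley_reisner_ideal_def
    by (rule genideal_minimal[OF ideal_avoiding[OF divisor_closed_supports(2)[OF assms]]])
       (auto simp: prod_var single_avoiding_iff keys_e)
  moreover have "p \<in> stanley_reisner_ideal \<Delta>" if p: "p \<in> ?I" for p
  proof (rule mpoly_mem_of_monomials)
    fix m assume m: "m \<in> keys p"
    then have "keys m \<notin> \<Delta>" using p by (auto simp: avoiding_def)
    then have "(\<Prod>v\<in>keys m. var v) \<in> ?G" by blast
    then have gen: "Poly_Mapping.single (e (keys m)) 1 \<in> (stanley_reisner_ideal \<Delta> :: ('v, 'k) mpoly set)"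
      unfolding stanley_reisner_ideal_def prod_var[symmetric] using genideal_self[of ?G] by auto
    \<comment> \<open>The truncated subtraction is exact, as \<open>m\<close> is at least
      \<open>1\<close> on its support.\<close>
    have "m = (m - e (keys m)) + e (keys m)"
      by (rule poly_mapping_eqI) (auto simp: lookup_add lookup_minus lookup_e in_keys_iff)
    then have "Poly_Mapping.single m (lookup p m) =
        Poly_Mapping.single (m - e (keys m)) (lookup p m) * Poly_Mapping.single (e (keys m)) 1"
      by (simp add: mult_single)
    with gen idl show "Poly_Mapping.single m (lookup p m) \<in> stanley_reisner_ideal \<Delta>"
      by (simp add: ideal_type_algebra_iff)
  qed (use idl in \<open>simp_all add: ideal_type_algebra_iff\<close>)
  ultimately show ?thesis by blast
qed

section \<open>Submodules of quotients and their chains\<close>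

lemma carrier_FactRing: "carrier (A Quot K) = (+>\<^bsub>A\<^esub>) K ` carrier A"
  by (auto simp: FactRing_def A_RCOSETS_def')

text \<open>Scalars of \<open>A\<close> act on the quotient through the surjection onto
  \<open>A Quot K\<close>, so absorbing them is the same as absorbing all elements of
  \<open>A Quot K\<close>.\<close>

lemma submodule_quotient_module_iff:
  assumes "cring A" "ideal K A"
  shows "submodule N A (quotient_module A K) \<longleftrightarrow> ideal N (A Quot K)"
proof -
  interpret A: cring A by fact
  interpret K: ideal K A by fact
  interpret Q: cring "A Quot K" using K.quotient_is_cring[OF assms(1)] .
  have add: "subgroup N (add_monoid (quotient_module A K)) \<longleftrightarrow> subgroup N (add_monoid (A Quot K))"
    by (simp add: quotient_module_def ring.defs subgroup_def m_inv_def)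
  have smult: "r \<odot>\<^bsub>quotient_module A K\<^esub> C = (K +>\<^bsub>A\<^esub> r) \<otimes>\<^bsub>A Quot K\<^esub> C" for r C
    by (simp add: quotient_module_def ring.defs)
  show ?thesis
  proof
    assume "submodule N A (quotient_module A K)"
    then have N: "subgroup N (add_monoid (A Quot K))"
      "\<And>r x. r \<in> carrier A \<Longrightarrow> x \<in> N \<Longrightarrow> (K +>\<^bsub>A\<^esub> r) \<otimes>\<^bsub>A Quot K\<^esub> x \<in> N"
      by (auto simp: submodule_def submodule_axioms_def add smult)
    then have l: "y \<otimes>\<^bsub>A Quot K\<^esub> x \<in> N" if "x \<in> N" "y \<in> carrier (A Quot K)" for x y
      using that by (auto simp: carrier_FactRing)
    have sub: "N \<subseteq> carrier (A Quot K)"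
      using subgroup.subset[OF N(1)] by simp
    show "ideal N (A Quot K)"
    proof (rule idealI[OF Q.ring_axioms N(1) l])
      fix x y assume "x \<in> N" "y \<in> carrier (A Quot K)"
      with l sub show "x \<otimes>\<^bsub>A Quot K\<^esub> y \<in> N" using Q.m_comm by (metis subsetD)
    qed auto
  next
    assume "ideal N (A Quot K)"
    then interpret N: ideal N "A Quot K" .
    show "submodule N A (quotient_module A K)"
      using N.a_subgroup N.I_l_closed
      by (auto simp: submodule_def submodule_axioms_def add smult carrier_FactRing)
  qed
qed

lemma (in ring_hom_ring) img_ideal:
  assumes "h ` carrier R = carrier S" "ideal L R"
  shows "ideal (h ` L) S"
proof -
  interpret L: ideal L R by fact
  show ?thesis
  proof (rule idealI[OF S.ring_axioms img_is_add_subgroup[OF L.a_subgroup]])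
    fix a x assume "a \<in> h ` L" "x \<in> carrier S"
    then obtain l r where lr: "l \<in> L" "a = h l" "r \<in> carrier R" "x = h r"
      using assms(1) by (metis imageE)
    then have "x \<otimes>\<^bsub>S\<^esub> a = h (r \<otimes> l)" "a \<otimes>\<^bsub>S\<^esub> x = h (l \<otimes> r)"
      by simp_all
    then show "x \<otimes>\<^bsub>S\<^esub> a \<in> h ` L" "a \<otimes>\<^bsub>S\<^esub> x \<in> h ` L"
      using L.I_l_closed[OF lr(1,3)] L.I_r_closed[OF lr(1,3)] by (metis image_eqI)+
  qed
qed

text \<open>Two elements with the same image differ by a kernel element, so an ideal above the
  kernel contains both or neither.\<close>

lemma (in ring_hom_ring) img_ideal_psubset:
  assumes L: "ideal L R" "a_kernel R S h \<subseteq> L" and L': "ideal L' R" "L \<subset> L'"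
  shows "h ` L \<subset> h ` L'"
proof -
  interpret L: ideal L R by fact
  interpret L': ideal L' R by fact
  obtain x where x: "x \<in> L'" "x \<notin> L" using L' by auto
  have "h x \<notin> h ` L"
  proof
    assume "h x \<in> h ` L"
    then obtain y where y: "y \<in> L" "h x = h y" by (rule imageE)
    have carr: "x \<in> carrier R" "y \<in> carrier R"
      by (fact L'.Icarr[OF x(1)], fact L.Icarr[OF y(1)])
    have "h (x \<ominus> y) = h x \<oplus>\<^bsub>S\<^esub> \<ominus>\<^bsub>S\<^esub> h x"
      unfolding R.minus_eq using carr y(2) hom_add[of x "\<ominus> y"] hom_a_inv[of y] R.a_inv_closed[of y] by metis
    also have "\<dots> = \<zero>\<^bsub>S\<^esub>"
      by (rule S.r_neg[OF hom_closed[OF carr(1)]])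
    finally have "x \<ominus> y \<in> a_kernel R S h"
      unfolding a_kernel_def' using R.minus_closed[OF carr] by blast
    then have "(x \<ominus> y) \<oplus> y \<in> L"
      using additive_subgroup.a_closed[OF L.is_additive_subgroup] L y(1) by blast
    also have "(x \<ominus> y) \<oplus> y = x"
      using carr by (simp add: R.minus_eq R.a_assoc R.l_neg)
    finally show False using x by simp
  qed
  with x(1) L'(2) show ?thesis by blast
qed

text \<open>The correspondence theorem for chains: pull back along \<open>h\<close> in one
  direction, take images in the other.\<close>

lemma (in ring_hom_ring) ideal_chain_iff:
  assumes "h ` carrier R = carrier S"
  shows "(\<exists>N. (\<forall>i\<le>n. ideal (N i) S) \<and> (\<forall>i<n. N i \<subset> N (Suc i))) \<longleftrightarrow>
    (\<exists>L. (\<forall>i\<le>n. ideal (L i) R \<and> a_kernel R S h \<subseteq> L i) \<and> (\<forall>i<(n::nat). L i \<subset> L (Suc i)))"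
    (is "?l \<longleftrightarrow> ?r")
proof
  assume ?l
  then obtain N where N: "\<And>i. i \<le> n \<Longrightarrow> ideal (N i) S" "\<And>i. i < n \<Longrightarrow> N i \<subset> N (Suc i)"
    by auto
  let ?L = "\<lambda>i. {r \<in> carrier R. h r \<in> N i}"
  \<comment> \<open>Surjectivity lifts a witness of strictness from \<open>S\<close> to
    \<open>R\<close>.\<close>
  have "?L i \<subset> ?L (Suc i)" if i: "i < n" for i
  proof -
    obtain x where x: "x \<in> N (Suc i)" "x \<notin> N i" using N(2)[OF i] by auto
    moreover have "x \<in> carrier S"
      using x N(1)[of "Suc i"] i by (auto intro: ideal.Icarr)
    then obtain r where "r \<in> carrier R" "x = h r" using assms by (metis imageE)
    ultimately show ?thesis using N(2)[OF i] by auto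
  qed
  moreover have "ideal (?L i) R \<and> a_kernel R S h \<subseteq> ?L i" if i: "i \<le> n" for i
  proof (rule conjI[OF ideal_vimage[OF N(1)[OF i]] subsetI])
    fix x assume "x \<in> a_kernel R S h"
    then have "x \<in> carrier R" "h x = \<zero>\<^bsub>S\<^esub>" unfolding a_kernel_def' by blast+
    then show "x \<in> ?L i"
      using additive_subgroup.zero_closed[OF ideal.axioms(1)[OF N(1)[OF i]]]
      by (metis (mono_tags, lifting) mem_Collect_eq)
  qed
  ultimately have "\<forall>i\<le>n. ideal (?L i) R \<and> a_kernel R S h \<subseteq> ?L i" "\<forall>i<n. ?L i \<subset> ?L (Suc i)"
    by simp_all
  then show ?r by - (rule exI[of _ ?L], rule conjI, assumption+)
next
  assume ?r
  then obtain L where L: "\<And>i. i \<le> n \<Longrightarrow> ideal (L i) R" "\<And>i. i \<le> n \<Longrightarrow> a_kernel R S h \<subseteq> L i"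
    "\<And>i. i < n \<Longrightarrow> L i \<subset> L (Suc i)" by auto
  have "h ` L i \<subset> h ` L (Suc i)" if "i < n" for i
    using that by (intro img_ideal_psubset L) auto
  then have "\<forall>i\<le>n. ideal (h ` L i) S" "\<forall>i<n. h ` L i \<subset> h ` L (Suc i)"
    using img_ideal[OF assms L(1)] by simp_all
  then show ?l by - (rule exI[of _ "\<lambda>i. h ` L i"], rule conjI, assumption+)
qed

text \<open>Submodules of the quotient correspond to polynomial ideals above
  \<open>avoiding E\<close>. Such ideals are subspaces, so the rank bound applies to their chains,
  and a chain of monomial ideals attains it.\<close>

lemma quotient_length_eq_card:
  fixes E :: "('v::finite \<Rightarrow>\<^sub>0 nat) set" and A :: "'a ring"
  assumes hom: "ring_hom_ring (mpoly_ring :: ('v, 'k::field) mpoly ring) A h" and surj: "range h = carrier A"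
    and A: "cring A" and K: "ideal K A" and pre: "h -` K = avoiding E"
    and E: "finite E" "divisor_closed E"
  shows "quotient_length A K = enat (card E)"
proof -
  let ?g = "\<lambda>p. K +>\<^bsub>A\<^esub> h p"
  have h_carr: "h p \<in> carrier A" for p
    using surj by blast
  have "ring_hom_ring mpoly_ring (A Quot K) ((+>\<^bsub>A\<^esub>) K \<circ> h)"
    using K hom by (intro ring_hom_ringI2 ring_hom_trans[of h _ A])
      (auto simp: ring_hom_ring_def ring_hom_ring_axioms_def intro: ideal.quotient_is_ring ideal.rcos_ring_hom)
  then have g: "ring_hom_ring (mpoly_ring :: ('v, 'k) mpoly ring) (A Quot K) ?g"
    unfolding o_def .
  have carr: "?g ` carrier mpoly_ring = carrier (A Quot K)"
    unfolding carrier_FactRing surj[symmetric] type_algebra_simps by (simp only: image_image)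
  \<comment> \<open>\<open>K\<close> is the zero of \<open>A Quot K\<close>, so this identifies the
    kernel of \<open>?g\<close> with the preimage of \<open>K\<close> under
    \<open>h\<close>.\<close>
  have "?g p = K \<longleftrightarrow> h p \<in> K" for p
    using abelian_subgroup.a_rcos_const[OF abelian_subgroupI3] ideal.rcos_const_imp_mem[OF K]
      ideal.axioms(1)[OF K] A h_carr[of p]
    by (metis cring.axioms(1) ring.axioms(1) ring_def)
  then have ker: "a_kernel mpoly_ring (A Quot K) ?g = avoiding E"
    unfolding pre[symmetric] a_kernel_def' by (auto simp: FactRing_def)
  have chain: "(\<exists>N. (\<forall>i\<le>n. submodule (N i) A (quotient_module A K)) \<and> (\<forall>i<n. N i \<subset> N (Suc i))) \<longleftrightarrow>
    (\<exists>L::nat \<Rightarrow> ('v, 'k) mpoly set. (\<forall>i\<le>n. ideal (L i) mpoly_ring \<and> avoiding E \<subseteq> L i) \<and> (\<forall>i<n. L i \<subset> L (Suc i)))" for n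
    using ring_hom_ring.ideal_chain_iff[OF g carr] unfolding submodule_quotient_module_iff[OF A K] ker .
  show ?thesis
    unfolding module_length_def chain
  proof (rule antisym)
    show "Sup {enat n |n. \<exists>L::nat \<Rightarrow> ('v, 'k) mpoly set. (\<forall>i\<le>n. ideal (L i) mpoly_ring \<and> avoiding E \<subseteq> L i)
            \<and> (\<forall>i<n. L i \<subset> L (Suc i))} \<le> enat (card E)"
    proof (rule Sup_least, safe)
      fix n and L :: "nat \<Rightarrow> ('v, 'k) mpoly set"
      assume L: "\<forall>i\<le>n. ideal (L i) mpoly_ring \<and> avoiding E \<subseteq> L i" "\<forall>i<n. L i \<subset> L (Suc i)"
      have "n \<le> card E"
        using L by (intro subspace_chain_length_le[of E n L] E)
          (auto simp: linear_subspace_def ideal_type_algebra_iff)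
      then show "enat n \<le> enat (card E)" by simp
    qed
    obtain F where F: "\<forall>i. divisor_closed (F i) \<and> F i \<subseteq> E" "\<forall>i<card E. F (Suc i) \<subset> F i"
      using avoiding_chain_exists[OF E] by blast
    define L where "L i = (avoiding (F i) :: ('v, 'k) mpoly set)" for i
    have "\<forall>i\<le>card E. ideal (L i) mpoly_ring \<and> avoiding E \<subseteq> L i"
      unfolding L_def using F ideal_avoiding avoiding_antimono by metis
    moreover have "\<forall>i<card E. L i \<subset> L (Suc i)"
      unfolding L_def using F avoiding_strict_antimono by metis
    ultimately have "\<exists>L::nat \<Rightarrow> ('v, 'k) mpoly set.
         (\<forall>i\<le>card E. ideal (L i) mpoly_ring \<and> avoiding E \<subseteq> L i) \<and> (\<forall>i<card E. L i \<subset> L (Suc i))"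
      by - (rule exI[of _ L], rule conjI, assumption+)
    then show "enat (card E) \<le> Sup {enat n |n. \<exists>L::nat \<Rightarrow> ('v, 'k) mpoly set.
         (\<forall>i\<le>n. ideal (L i) mpoly_ring \<and> avoiding E \<subseteq> L i) \<and> (\<forall>i<n. L i \<subset> L (Suc i))}"
      by (intro Sup_upper) blast
  qed
qed

section \<open>Powers of the maximal homogeneous ideal\<close>

text \<open>The graded lexicographic order, pulled back from the lexicographic order on
  \<open>nat \<Rightarrow>\<^sub>0 nat\<close>. Coordinate \<open>0\<close> stores the total degree
  and is compared first; the numbering \<open>e\<close> of the vertices, shifted by one, fills the
  others.\<close>

lemma monomial_order_exists:
  obtains \<phi> :: "('v::finite \<Rightarrow>\<^sub>0 nat) \<Rightarrow> (nat \<Rightarrow>\<^sub>0 nat)" where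
    "inj \<phi>" "\<And>a b. \<phi> (a + b) = \<phi> a + \<phi> b"
    "\<And>a b. \<phi> a \<le> \<phi> b \<Longrightarrow> total_degree a \<le> total_degree b"
proof -
  obtain e :: "'v \<Rightarrow> nat" where e: "inj e"
    using finite_imp_inj_to_nat_seg[OF finite[of "UNIV :: 'v set"]] by blast
  define \<phi> :: "('v \<Rightarrow>\<^sub>0 nat) \<Rightarrow> (nat \<Rightarrow>\<^sub>0 nat)" where
    "\<phi> m = Poly_Mapping.single 0 (total_degree m) + (\<Sum>v\<in>UNIV. Poly_Mapping.single (Suc (e v)) (lookup m v))" for m
  have lookup_0: "lookup (\<phi> m) 0 = total_degree m" for m
    by (simp add: \<phi>_def lookup_add lookup_sum lookup_single)
  have lookup_Suc: "lookup (\<phi> m) (Suc (e v)) = lookup m v" for m v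
    using e by (simp add: \<phi>_def lookup_add lookup_sum lookup_single when_def inj_eq)
  show thesis
  proof
    show "inj \<phi>"
      by (rule injI, rule poly_mapping_eqI) (metis lookup_Suc)
    show "\<phi> (a + b) = \<phi> a + \<phi> b" for a b
      by (simp add: \<phi>_def single_add lookup_add sum.distrib add_ac)
    show "total_degree a \<le> total_degree b" if "\<phi> a \<le> \<phi> b" for a b
      using that unfolding less_eq_poly_mapping.rep_eq less_fun_def
      by (metis bot_nat_0.not_eq_extremum le_less lookup_0 poly_mapping.lookup_inject)
  qed
qed

text \<open>The preimage of \<open>\<mm>\<^sup>n\<close> in the polynomial ring.\<close>

definition high_degree :: "'v::finite set set \<Rightarrow> nat \<Rightarrow> ('v, 'k::field) mpoly set" where
  "high_degree \<Delta> n = avoiding {m. keys m \<in> \<Delta> \<and> total_degree m < n}"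

lemma high_degree_0 [simp]: "high_degree \<Delta> 0 = UNIV"
  by (simp add: high_degree_def avoiding_def)

lemma high_degree_antimono: "a \<le> b \<Longrightarrow> high_degree \<Delta> b \<subseteq> high_degree \<Delta> a"
  unfolding high_degree_def by (rule avoiding_antimono) auto

lemma ideal_high_degree:
  "simplicial_complex \<Delta> \<Longrightarrow> ideal (high_degree \<Delta> n :: ('v::finite, 'k::field) mpoly set) mpoly_ring"
  unfolding high_degree_def by (intro ideal_avoiding divisor_closed_supports)

lemma stanley_reisner_subset_high_degree:
  "simplicial_complex \<Delta> \<Longrightarrow> stanley_reisner_ideal \<Delta> \<subseteq> (high_degree \<Delta> n :: ('v::finite, 'k::field) mpoly set)"
  unfolding stanley_reisner_ideal_eq high_degree_def by (rule avoiding_antimono) auto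

lemma var_high_degree: "var v \<in> (high_degree \<Delta> 1 :: ('v::finite, 'k::field) mpoly set)"
  unfolding var_def high_degree_def single_avoiding_iff mem_Collect_eq total_degree_single by simp

text \<open>If a product monomial is supported on a face, so are its two factors; both degree bounds
  then apply and add up.\<close>

lemma high_degree_mult:
  fixes p q :: "('v::finite, 'k::field) mpoly"
  assumes \<Delta>: "simplicial_complex \<Delta>" and "p \<in> high_degree \<Delta> a" "q \<in> high_degree \<Delta> b"
  shows "p * q \<in> high_degree \<Delta> (a + b)"
proof -
  have "a + b \<le> total_degree m" if m: "m \<in> keys (p * q)" "keys m \<in> \<Delta>" for m
  proof -
    obtain s t where st: "m = s + t" "s \<in> keys p" "t \<in> keys q"
      using keys_mult[of p q] m(1) by blast
    then have "keys s \<in> \<Delta>" "keys t \<in> \<Delta>"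
      using m(2) \<Delta> by (auto simp: simplicial_complex_def keys_plus_nat)
    then have "a \<le> total_degree s" "b \<le> total_degree t"
      using st assms(2,3) by (auto simp: high_degree_def avoiding_def not_less)
    with st(1) show ?thesis by simp
  qed
  then show ?thesis by (force simp: high_degree_def avoiding_def)
qed

lemma high_degree_power:
  "simplicial_complex \<Delta> \<Longrightarrow> (p :: ('v::finite, 'k::field) mpoly) \<in> high_degree \<Delta> r \<Longrightarrow> p ^ n \<in> high_degree \<Delta> (r * n)"
  by (induction n) (auto simp: high_degree_mult algebra_simps)

text \<open>No cancellation occurs in lowest degree: restricting to a single face leaves a
  polynomial ring over a field, where initial monomials multiply.\<close>

lemma power_notin_high_degree:
  fixes p :: "('v::finite, 'k::field) mpoly"
  assumes \<Delta>: "simplicial_complex \<Delta>" and p: "p \<in> high_degree \<Delta> r" "p \<notin> high_degree \<Delta> (Suc r)"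
  shows "p ^ n \<notin> high_degree \<Delta> (Suc (r * n))"
proof -
  obtain \<phi> :: "('v \<Rightarrow>\<^sub>0 nat) \<Rightarrow> (nat \<Rightarrow>\<^sub>0 nat)" where inj: "inj \<phi>"
    and add: "\<And>a b. \<phi> (a + b) = \<phi> a + \<phi> b"
    and deg: "\<And>a b. \<phi> a \<le> \<phi> b \<Longrightarrow> total_degree a \<le> total_degree b"
    using monomial_order_exists by blast
  \<comment> \<open>The monomials of \<open>p\<close> that survive in the face ring.\<close>
  let ?T = "{m \<in> keys p. keys m \<in> \<Delta>}"
  obtain m1 where m1: "m1 \<in> ?T" "total_degree m1 \<le> r"
    using p(2) by (auto simp: high_degree_def avoiding_def less_Suc_eq_le)
  have fin: "finite (\<phi> ` ?T)" by simp
  then have "Min (\<phi> ` ?T) \<in> \<phi> ` ?T" using m1(1) by (intro Min_in) blast+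
  then obtain m0 where m0: "Min (\<phi> ` ?T) = \<phi> m0" "m0 \<in> ?T" by (rule imageE)
  have min: "\<phi> m0 \<le> \<phi> m" if "m \<in> ?T" for m
    unfolding m0(1)[symmetric] by (rule Min_le[OF fin imageI[OF that]])
  \<comment> \<open>At most \<open>r\<close> because \<open>\<phi>\<close> compares degrees first,
    at least \<open>r\<close> because \<open>p\<close> lies in
    \<open>high_degree \<Delta> r\<close>.\<close>
  have "total_degree m0 = r"
    using deg[OF min[OF m1(1)]] m1 m0(2) p(1) by (force simp: high_degree_def avoiding_def)
  \<comment> \<open>Setting the variables outside \<open>keys m0\<close> to zero, \<open>m0\<close> is the initial monomial of \<open>p\<close>,
    and its \<open>n\<close>-th power is the initial monomial of \<open>p ^ n\<close>.\<close>
  define c where "c = lookup p m0"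
  define M where "M n = ((+) m0 ^^ n) 0" for n
  have M_simps: "M 0 = 0" "M (Suc n) = m0 + M n" for n
    by (simp_all add: M_def)
  have keys_M: "keys (M n) \<subseteq> keys m0" for n
    by (induction n) (auto simp: M_simps keys_plus_nat)
  have deg_M: "total_degree (M n) = r * n" for n
    by (induction n) (auto simp: M_simps \<open>total_degree m0 = r\<close>)
  \<comment> \<open>Looking only at monomials supported in \<open>keys m0\<close>,
    \<open>G \<mu>\<close> consists of the polynomials of order greater than \<open>\<mu>\<close>
    and \<open>W \<mu>\<close> of those of order at least \<open>\<mu>\<close>.\<close>
  define G where "G \<mu> = (avoiding {m. keys m \<subseteq> keys m0 \<and> \<phi> m \<le> \<mu>} :: ('v, 'k) mpoly set)" for \<mu>
  define W where "W \<mu> = (avoiding {m. keys m \<subseteq> keys m0 \<and> \<phi> m < \<mu>} :: ('v, 'k) mpoly set)" for \<mu>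
  have WG: "f * g \<in> G (\<mu> + \<nu>)" if f: "f \<in> W \<mu>" and g: "g \<in> G \<nu>" for f g \<mu> \<nu>
  proof -
    have "\<mu> + \<nu> < \<phi> m" if m: "m \<in> keys (f * g)" "keys m \<subseteq> keys m0" for m
    proof -
      obtain s t where st: "m = s + t" "s \<in> keys f" "t \<in> keys g"
        using keys_mult[of f g] m(1) by blast
      then have "\<mu> \<le> \<phi> s" "\<nu> < \<phi> t"
        using m(2) f g by (auto simp: G_def W_def avoiding_def keys_plus_nat not_less not_le)
      then show ?thesis using st(1) by (simp add: add add_le_less_mono)
    qed
    then show ?thesis by (force simp: G_def avoiding_def)
  qed
  have sub_keys: "keys m \<in> \<Delta>" if "keys m \<subseteq> keys m0" for m
    using that m0(2) \<Delta> by (auto simp: simplicial_complex_def)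
  have "\<not> \<phi> m < \<phi> m0" if "m \<in> keys p" "keys m \<subseteq> keys m0" for m
    using min[of m] sub_keys[OF that(2)] that(1) by simp
  then have p_W: "p \<in> W (\<phi> m0)"
    by (auto simp: W_def avoiding_def)
  have "lookup (p - Poly_Mapping.single m0 c) m = 0" if m: "keys m \<subseteq> keys m0" "\<phi> m \<le> \<phi> m0" for m
  proof (cases "m = m0")
    case True
    then show ?thesis by (simp add: lookup_minus c_def)
  next
    case False
    then have "\<not> \<phi> m0 \<le> \<phi> m" using m(2) inj by (auto simp: inj_eq dest: antisym)
    then have "m \<notin> keys p" using min[of m] sub_keys[OF m(1)] by blast
    then show ?thesis using False by (simp add: lookup_minus lookup_single in_keys_iff)
  qed
  then have p_G: "p - Poly_Mapping.single m0 c \<in> G (\<phi> m0)"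
    by (simp add: G_def avoiding_iff)
  have "p ^ n - Poly_Mapping.single (M n) (c ^ n) \<in> G (\<phi> (M n))"
  proof (induction n)
    case 0
    then show ?case by (simp add: M_simps G_def)
  next
    case (Suc n)
    \<comment> \<open>A telescoping identity: in each summand one factor satisfies a weak order
      bound and the other a strict one, as \<open>WG\<close> requires.\<close>
    have "p ^ Suc n - Poly_Mapping.single (M (Suc n)) (c ^ Suc n) =
        p * (p ^ n - Poly_Mapping.single (M n) (c ^ n)) +
        Poly_Mapping.single (M n) (c ^ n) * (p - Poly_Mapping.single m0 c)"
      by (simp add: M_simps algebra_simps mult_single)
    moreover have "Poly_Mapping.single (M n) (c ^ n) \<in> W (\<phi> (M n))"
      by (simp add: W_def single_avoiding_iff)
    ultimately show ?case
      using WG[OF p_W Suc] WG[OF _ p_G, of "Poly_Mapping.single (M n) (c ^ n)" "\<phi> (M n)"]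
      by (auto simp: M_simps add add_ac G_def intro: add_avoiding)
  qed
  then have "lookup (p ^ n - Poly_Mapping.single (M n) (c ^ n)) (M n) = 0"
    using keys_M[of n] by (simp add: G_def avoiding_iff)
  \<comment> \<open>This coefficient is \<open>c ^ n\<close>, nonzero in a field.\<close>
  then have "lookup (p ^ n) (M n) \<noteq> 0"
    using m0(2) by (simp add: lookup_minus c_def in_keys_iff)
  then show ?thesis
    using sub_keys[OF keys_M] deg_M
    by (auto simp: high_degree_def avoiding_iff intro!: exI[of _ "M n"])
qed

section \<open>Computing in the face ring with representatives\<close>

definition face_proj :: "'v::finite set set \<Rightarrow> ('v, 'k::field) mpoly \<Rightarrow> ('v, 'k) mpoly set" where
  "face_proj \<Delta> p = stanley_reisner_ideal \<Delta> +>\<^bsub>mpoly_ring\<^esub> p"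

lemma ideal_stanley_reisner: "ideal (stanley_reisner_ideal \<Delta> :: ('v::finite, 'k::field) mpoly set) mpoly_ring"
  unfolding stanley_reisner_ideal_def by (rule ring.genideal_ideal) auto

lemma cring_face_ring: "cring (face_ring \<Delta> :: ('v::finite, 'k::field) mpoly set ring)"
  unfolding face_ring_def by (rule ideal.quotient_is_cring[OF ideal_stanley_reisner]) simp

lemma face_proj_hom: "ring_hom_ring (mpoly_ring :: ('v::finite, 'k::field) mpoly ring) (face_ring \<Delta>) (face_proj \<Delta>)"
  using ideal.rcos_ring_hom_ring[OF ideal_stanley_reisner]
  unfolding face_ring_def by (simp add: face_proj_def[abs_def])

lemma carrier_face_ring: "carrier (face_ring \<Delta>) = range (face_proj \<Delta> :: ('v::finite, 'k::field) mpoly \<Rightarrow> _)"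
  by (simp add: face_ring_def carrier_FactRing face_proj_def[abs_def])

lemma face_proj_simps:
  fixes p q :: "('v::finite, 'k::field) mpoly"
  shows "face_proj \<Delta> p \<oplus>\<^bsub>face_ring \<Delta>\<^esub> face_proj \<Delta> q = face_proj \<Delta> (p + q)"
    and "face_proj \<Delta> p \<otimes>\<^bsub>face_ring \<Delta>\<^esub> face_proj \<Delta> q = face_proj \<Delta> (p * q)"
    and "\<one>\<^bsub>face_ring \<Delta>\<^esub> = (face_proj \<Delta> 1 :: ('v, 'k) mpoly set)"
    and "\<zero>\<^bsub>face_ring \<Delta>\<^esub> = (face_proj \<Delta> 0 :: ('v, 'k) mpoly set)"
    and "face_proj \<Delta> p [^]\<^bsub>face_ring \<Delta>\<^esub> (n::nat) = face_proj \<Delta> (p ^ n)"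
proof -
  have hom: "face_proj \<Delta> \<in> ring_hom mpoly_ring (face_ring \<Delta> :: ('v, 'k) mpoly set ring)"
    by (rule ring_hom_ring.homh[OF face_proj_hom])
  show "face_proj \<Delta> p \<oplus>\<^bsub>face_ring \<Delta>\<^esub> face_proj \<Delta> q = face_proj \<Delta> (p + q)"
    using ring_hom_add[OF hom, of p q] by simp
  show mult: "face_proj \<Delta> p \<otimes>\<^bsub>face_ring \<Delta>\<^esub> face_proj \<Delta> q = face_proj \<Delta> (p * q)" for p q :: "('v, 'k) mpoly"
    using ring_hom_mult[OF hom, of p q] by simp
  show one: "\<one>\<^bsub>face_ring \<Delta>\<^esub> = (face_proj \<Delta> 1 :: ('v, 'k) mpoly set)"
    using ring_hom_one[OF hom] by simp
  show "\<zero>\<^bsub>face_ring \<Delta>\<^esub> = (face_proj \<Delta> 0 :: ('v, 'k) mpoly set)"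
    using ring_hom_zero[OF hom ring_type_algebra cring.axioms(1)[OF cring_face_ring]] by simp
  show "face_proj \<Delta> p [^]\<^bsub>face_ring \<Delta>\<^esub> (n::nat) = face_proj \<Delta> (p ^ n)"
    by (induction n) (simp_all add: nat_pow_def one mult mult.commute)
qed

lemma face_proj_eq_iff:
  "face_proj \<Delta> p = face_proj \<Delta> q \<longleftrightarrow> p - q \<in> (stanley_reisner_ideal \<Delta> :: ('v::finite, 'k::field) mpoly set)"
  using ring.quotient_eq_iff_same_a_r_cos[OF _ ideal_stanley_reisner, of p q \<Delta>]
  by (simp add: face_proj_def a_minus_def)

lemma face_proj_vimage_image:
  fixes L :: "('v::finite, 'k::field) mpoly set"
  assumes "ideal L mpoly_ring" "stanley_reisner_ideal \<Delta> \<subseteq> L"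
  shows "face_proj \<Delta> -` face_proj \<Delta> ` L = L"
proof -
  have "p \<in> L" if "face_proj \<Delta> p = face_proj \<Delta> q" "q \<in> L" for p q
  proof -
    have "(p - q) + q \<in> L"
      using that assms unfolding face_proj_eq_iff ideal_type_algebra_iff by blast
    then show ?thesis by simp
  qed
  then show ?thesis by auto
qed

lemma ideal_face_proj_image:
  fixes L :: "('v::finite, 'k::field) mpoly set"
  assumes "ideal L mpoly_ring"
  shows "ideal (face_proj \<Delta> ` L) (face_ring \<Delta>)"
  using ring_hom_ring.img_ideal[OF face_proj_hom _ assms] by (simp add: carrier_face_ring)

section \<open>The maximal homogeneous ideal and its powers\<close>

text \<open>A nonconstant monomial is a multiple of a variable, and a monomial supported off the
  complex vanishes in the face ring.\<close>

lemma max_homogeneous_ideal_eq: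
  assumes \<Delta>: "simplicial_complex (\<Delta> :: 'v::finite set set)"
  shows "max_homogeneous_ideal \<Delta> = face_proj \<Delta> ` (high_degree \<Delta> 1 :: ('v, 'k::field) mpoly set)"
    (is "?m = _")
proof
  have ring: "ring (face_ring \<Delta> :: ('v, 'k) mpoly set ring)"
    by (rule cring.axioms(1)[OF cring_face_ring])
  have gens: "{stanley_reisner_ideal \<Delta> +>\<^bsub>mpoly_ring\<^esub> var v |v. True} = range (\<lambda>v. face_proj \<Delta> (var v :: ('v, 'k) mpoly))"
    by (auto simp: face_proj_def)
  have carr: "range (\<lambda>v. face_proj \<Delta> (var v :: ('v, 'k) mpoly)) \<subseteq> carrier (face_ring \<Delta>)"
    by (auto simp: carrier_face_ring)
  show "?m \<subseteq> face_proj \<Delta> ` high_degree \<Delta> 1"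
    unfolding max_homogeneous_ideal_def gens
    by (rule ring.genideal_minimal[OF ring ideal_face_proj_image[OF ideal_high_degree[OF \<Delta>]]])
       (use var_high_degree in auto)
  have idl: "ideal ?m (face_ring \<Delta>)"
    unfolding max_homogeneous_ideal_def gens by (rule ring.genideal_ideal[OF ring carr])
  have var_m: "face_proj \<Delta> (var v) \<in> ?m" for v
    using ring.genideal_self[OF ring carr] unfolding max_homogeneous_ideal_def gens by blast
  have "p \<in> face_proj \<Delta> -` ?m" if p: "p \<in> high_degree \<Delta> 1" for p :: "('v, 'k) mpoly"
  proof (rule mpoly_mem_of_monomials)
    show "0 \<in> face_proj \<Delta> -` ?m"
      using additive_subgroup.zero_closed[OF ideal.axioms(1)[OF idl]] by (simp add: face_proj_simps)
    show "f + g \<in> face_proj \<Delta> -` ?m" if "f \<in> face_proj \<Delta> -` ?m" "g \<in> face_proj \<Delta> -` ?m" for f g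
      using additive_subgroup.a_closed[OF ideal.axioms(1)[OF idl]] that
      by (simp flip: face_proj_simps(1))
    fix m assume m: "m \<in> keys p"
    let ?x = "Poly_Mapping.single m (lookup p m)"
    show "?x \<in> face_proj \<Delta> -` ?m"
    proof (cases "keys m \<in> \<Delta>")
      case True
      \<comment> \<open>The exponent \<open>0\<close> would have support in \<open>\<Delta>\<close>
        and degree below \<open>1\<close>, which \<open>p\<close> avoids.\<close>
      then have "m \<noteq> 0" using p m by (auto simp: high_degree_def avoiding_def)
      then obtain v where v: "v \<in> keys m" by (metis ex_in_conv keys_eq_empty)
      have "m = (m - Poly_Mapping.single v 1) + Poly_Mapping.single v 1"
        using v by (intro poly_mapping_eqI) (auto simp: lookup_add lookup_minus lookup_single when_def in_keys_iff)
      then have "?x = Poly_Mapping.single (m - Poly_Mapping.single v 1) (lookup p m) * var v"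
        by (simp add: var_def mult_single)
      then show ?thesis
        using ideal.I_l_closed[OF idl var_m] by (simp add: carrier_face_ring flip: face_proj_simps(2))
    next
      case False
      then have "?x \<in> stanley_reisner_ideal \<Delta>"
        by (simp add: stanley_reisner_ideal_eq[OF \<Delta>] single_avoiding_iff)
      then have "face_proj \<Delta> ?x = \<zero>\<^bsub>face_ring \<Delta>\<^esub>"
        by (simp add: face_proj_simps face_proj_eq_iff)
      then show ?thesis
        using additive_subgroup.zero_closed[OF ideal.axioms(1)[OF idl]] by simp
    qed
  qed
  then show "face_proj \<Delta> ` high_degree \<Delta> 1 \<subseteq> ?m" by auto
qed

lemma ideal_power_0: "ideal_power R K 0 = carrier R"
  and ideal_power_Suc: "ideal_power R K (Suc n) = ideal_prod R (ideal_power R K n) K"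
  by (simp_all add: nat_pow_def ideals_set_def)

lemma ideal_prod_high_degree_subset:
  assumes \<Delta>: "simplicial_complex \<Delta>"
  shows "ideal_prod (face_ring \<Delta>) (face_proj \<Delta> ` high_degree \<Delta> a) (face_proj \<Delta> ` high_degree \<Delta> b)
    \<subseteq> face_proj \<Delta> ` (high_degree \<Delta> (a + b) :: ('v::finite, 'k::field) mpoly set)"
proof
  fix x :: "('v, 'k) mpoly set"
  assume "x \<in> ideal_prod (face_ring \<Delta>) (face_proj \<Delta> ` high_degree \<Delta> a) (face_proj \<Delta> ` high_degree \<Delta> b)"
  then show "x \<in> face_proj \<Delta> ` high_degree \<Delta> (a + b)"
  proof induction
    case (prod i j)
    then obtain p q where "i = face_proj \<Delta> p" "p \<in> high_degree \<Delta> a" "j = face_proj \<Delta> q" "q \<in> high_degree \<Delta> b"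
      by blast
    then show ?case using high_degree_mult[OF \<Delta>, of p a q b] by (simp add: face_proj_simps)
  next
    case (sum s t)
    then show ?case
      using ideal_high_degree[OF \<Delta>, of "a + b"] by (auto simp: face_proj_simps ideal_type_algebra_iff)
  qed
qed

text \<open>This bounds from below the degrees of the coefficients in an equation of integral
  dependence.\<close>

lemma ideal_power_high_degree_subset:
  assumes \<Delta>: "simplicial_complex \<Delta>"
  shows "ideal_power (face_ring \<Delta>) (face_proj \<Delta> ` high_degree \<Delta> n) i
    \<subseteq> face_proj \<Delta> ` (high_degree \<Delta> (n * i) :: ('v::finite, 'k::field) mpoly set)"
proof (induction i)
  case 0
  then show ?case unfolding ideal_power_0 carrier_face_ring by simp
next
  case (Suc i)
  have "ideal_prod (face_ring \<Delta>) (ideal_power (face_ring \<Delta>) (face_proj \<Delta> ` high_degree \<Delta> n) i) (face_proj \<Delta> ` high_degree \<Delta> n)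
    \<subseteq> ideal_prod (face_ring \<Delta>) (face_proj \<Delta> ` high_degree \<Delta> (n * i)) (face_proj \<Delta> ` (high_degree \<Delta> n :: ('v, 'k) mpoly set))"
    (is "?P \<subseteq> ?Q")
  proof
    fix x assume "x \<in> ?P"
    then show "x \<in> ?Q" by induction (use Suc in \<open>auto intro: ideal_prod.intros\<close>)
  qed
  also have "\<dots> \<subseteq> face_proj \<Delta> ` high_degree \<Delta> (n * i + n)"
    by (rule ideal_prod_high_degree_subset[OF \<Delta>])
  finally show ?case unfolding ideal_power_Suc by (simp add: add.commute)
qed

text \<open>A monomial of degree at least \<open>n + 1\<close> is a variable times a monomial of
  degree at least \<open>n\<close>; the converse inclusion adds degrees.\<close>

lemma ideal_power_max_homogeneous_ideal:
  assumes \<Delta>: "simplicial_complex \<Delta>"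
  shows "ideal_power (face_ring \<Delta>) (max_homogeneous_ideal \<Delta>) n
    = face_proj \<Delta> ` (high_degree \<Delta> n :: ('v::finite, 'k::field) mpoly set)"
proof (induction n)
  case 0
  then show ?case unfolding ideal_power_0 carrier_face_ring by simp
next
  case (Suc n)
  let ?A = "face_ring \<Delta> :: ('v, 'k) mpoly set ring"
  let ?P = "ideal_prod ?A (face_proj \<Delta> ` high_degree \<Delta> n) (face_proj \<Delta> ` high_degree \<Delta> 1)"
  have idl: "ideal ?P ?A"
    by (intro ring.ideal_prod_is_ideal cring.axioms(1)[OF cring_face_ring]
          ideal_face_proj_image ideal_high_degree \<Delta>)
  have "p \<in> face_proj \<Delta> -` ?P" if p: "p \<in> high_degree \<Delta> (Suc n)" for p :: "('v, 'k) mpoly"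
  proof (rule mpoly_mem_of_monomials)
    show "0 \<in> face_proj \<Delta> -` ?P"
      using additive_subgroup.zero_closed[OF ideal.axioms(1)[OF idl]] by (simp add: face_proj_simps)
    show "f + g \<in> face_proj \<Delta> -` ?P" if "f \<in> face_proj \<Delta> -` ?P" "g \<in> face_proj \<Delta> -` ?P" for f g
      using additive_subgroup.a_closed[OF ideal.axioms(1)[OF idl]] that
      by (simp flip: face_proj_simps(1))
    fix m assume m: "m \<in> keys p"
    let ?x = "Poly_Mapping.single m (lookup p m)"
    show "?x \<in> face_proj \<Delta> -` ?P"
    proof (cases "keys m \<in> \<Delta>")
      case True
      then have deg: "Suc n \<le> total_degree m"
        using p m by (auto simp: high_degree_def avoiding_def not_less)
      then have "m \<noteq> 0" by auto
      then obtain v where v: "v \<in> keys m" by (metis ex_in_conv keys_eq_empty)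
      define m' where "m' = m - Poly_Mapping.single v 1"
      have m': "m = m' + Poly_Mapping.single v 1"
        using v unfolding m'_def
        by (intro poly_mapping_eqI) (auto simp: lookup_add lookup_minus lookup_single when_def in_keys_iff)
      have "Poly_Mapping.single m' (lookup p m) \<in> high_degree \<Delta> n"
        using deg arg_cong[OF m', of total_degree] by (auto simp: high_degree_def single_avoiding_iff)
      moreover have "?x = Poly_Mapping.single m' (lookup p m) * var v"
        using m' by (simp add: var_def mult_single)
      ultimately show ?thesis
        using var_high_degree[of v \<Delta>, where 'k = 'k]
        by (auto simp flip: face_proj_simps(2) intro: ideal_prod.prod)
    next
      case False
      then have "?x \<in> stanley_reisner_ideal \<Delta>"
        by (simp add: stanley_reisner_ideal_eq[OF \<Delta>] single_avoiding_iff)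
      then have "face_proj \<Delta> ?x = \<zero>\<^bsub>?A\<^esub>"
        by (simp add: face_proj_simps face_proj_eq_iff)
      then show ?thesis
        using additive_subgroup.zero_closed[OF ideal.axioms(1)[OF idl]] by simp
    qed
  qed
  then have "face_proj \<Delta> ` high_degree \<Delta> (Suc n) \<subseteq> ?P" by auto
  moreover have "?P \<subseteq> face_proj \<Delta> ` high_degree \<Delta> (Suc n)"
    using ideal_prod_high_degree_subset[OF \<Delta>, of n 1] by simp
  ultimately show ?case
    unfolding ideal_power_Suc Suc unfolding max_homogeneous_ideal_eq[OF \<Delta>] by (rule subset_antisym[rotated])
qed

section \<open>Integral closures of the powers\<close>

lemma finsum_face_proj:
  assumes "finite B"
  shows "finsum (face_ring \<Delta>) (\<lambda>i. face_proj \<Delta> (f i)) B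
    = (face_proj \<Delta> (\<Sum>i\<in>B. f i) :: ('v::finite, 'k::field) mpoly set)"
proof -
  interpret A: cring "face_ring \<Delta> :: ('v, 'k) mpoly set ring" by (rule cring_face_ring)
  show ?thesis
    using assms
    by (induction B) (simp_all add: A.finsum_insert carrier_face_ring Pi_def face_proj_simps)
qed

lemma ideal_integral_closure_high_degree:
  fixes \<Delta> :: "'v::finite set set"
  assumes \<Delta>: "simplicial_complex \<Delta>"
  shows "ideal_integral_closure (face_ring \<Delta>) (face_proj \<Delta> ` high_degree \<Delta> n)
    = face_proj \<Delta> ` (high_degree \<Delta> n :: ('v, 'k::field) mpoly set)"
    (is "ideal_integral_closure ?A ?K = _")
proof
  interpret A: cring ?A by (rule cring_face_ring)
  have idl: "ideal ?K ?A"
    by (intro ideal_face_proj_image ideal_high_degree \<Delta>)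
  have power_1: "ideal_power ?A ?K 1 = ?K"
    using A.ideal_prod_commute[OF idl A.oneideal] A.ideal_prod_one[OF idl]
    unfolding One_nat_def ideal_power_Suc ideal_power_0 by simp
  show "?K \<subseteq> ideal_integral_closure ?A ?K"
  proof
    fix x assume x: "x \<in> ?K"
    then have carr: "x \<in> carrier ?A" by (auto simp: carrier_face_ring)
    \<comment> \<open>The equation \<open>x + (- x) = 0\<close> of degree \<open>1\<close>.\<close>
    define a where "a i = (if i = 0 then \<one>\<^bsub>?A\<^esub> else \<ominus>\<^bsub>?A\<^esub> x)" for i :: nat
    have "(\<Oplus>\<^bsub>?A\<^esub>i\<in>{..1::nat}. a i \<otimes>\<^bsub>?A\<^esub> x [^]\<^bsub>?A\<^esub> (1 - i)) = \<zero>\<^bsub>?A\<^esub>"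
      using carr by (simp add: atMost_Suc a_def A.l_neg)
    moreover have "\<forall>i\<in>{1..1}. a i \<in> ideal_power ?A ?K i"
      using additive_subgroup.a_inv_closed[OF ideal.axioms(1)[OF idl] x] power_1 by (simp add: a_def)
    ultimately show "x \<in> ideal_integral_closure ?A ?K"
      unfolding ideal_integral_closure_def using carr
      by (intro CollectI conjI exI[of _ 1] exI[of _ a]) (simp_all add: a_def)
  qed
  show "ideal_integral_closure ?A ?K \<subseteq> ?K"
  proof
    fix x assume "x \<in> ideal_integral_closure ?A ?K"
    then obtain N a where x: "x \<in> carrier ?A" and N: "N \<ge> 1" and a0: "a 0 = \<one>\<^bsub>?A\<^esub>"
      and a: "\<And>i. i \<in> {1..N} \<Longrightarrow> a i \<in> ideal_power ?A ?K i"
      and eq: "(\<Oplus>\<^bsub>?A\<^esub>i\<in>{..N}. a i \<otimes>\<^bsub>?A\<^esub> x [^]\<^bsub>?A\<^esub> (N - i)) = \<zero>\<^bsub>?A\<^esub>"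
      unfolding ideal_integral_closure_def by blast
    obtain p where p: "x = face_proj \<Delta> p" using x by (auto simp: carrier_face_ring)
    \<comment> \<open>Lift the coefficients to polynomials. The lift of the leading one is fixed to
      be \<open>1\<close>, so that the lifted sum starts with \<open>p ^ N\<close>.\<close>
    have "\<exists>q. a i = face_proj \<Delta> q \<and> q \<in> high_degree \<Delta> (n * i) \<and> (i = 0 \<longrightarrow> q = 1)" if "i \<le> N" for i
    proof (cases "i = 0")
      case True
      then show ?thesis using a0 by (auto simp: face_proj_simps)
    next
      case False
      then show ?thesis
        using a[of i] that ideal_power_high_degree_subset[OF \<Delta>, of n i] by auto
    qed
    then obtain q where q: "\<And>i. i \<le> N \<Longrightarrow> a i = face_proj \<Delta> (q i)"
      "\<And>i. i \<le> N \<Longrightarrow> q i \<in> high_degree \<Delta> (n * i)" "q 0 = 1"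
      by (metis zero_le)
    let ?t = "\<lambda>i. q i * p ^ (N - i)"
    have "(\<Oplus>\<^bsub>?A\<^esub>i\<in>{..N}. a i \<otimes>\<^bsub>?A\<^esub> x [^]\<^bsub>?A\<^esub> (N - i)) = (\<Oplus>\<^bsub>?A\<^esub>i\<in>{..N}. face_proj \<Delta> (?t i))"
      by (rule A.finsum_cong') (auto simp: q p face_proj_simps carrier_face_ring)
    then have "face_proj \<Delta> (\<Sum>i\<le>N. ?t i) = face_proj \<Delta> 0"
      using eq by (simp add: finsum_face_proj face_proj_simps)
    \<comment> \<open>The lifted equation holds modulo the Stanley-Reisner ideal, which lies in
      \<open>high_degree \<Delta> k\<close> for every \<open>k\<close>.\<close>
    then have sum_mem: "(\<Sum>i\<le>N. ?t i) \<in> high_degree \<Delta> k" for k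
      using stanley_reisner_subset_high_degree[OF \<Delta>] by (auto simp: face_proj_eq_iff)
    have sum_split: "(\<Sum>i\<le>N. ?t i) = p ^ N + (\<Sum>i\<in>{1..N}. ?t i)"
      using q(3) by (simp add: atMost_atLeast0 sum.atLeast_Suc_atMost)
    have "p \<in> high_degree \<Delta> n"
    proof (rule ccontr)
      assume notin: "p \<notin> high_degree \<Delta> n"
      \<comment> \<open>\<open>r\<close> is the least degree of a monomial of \<open>p\<close>
        supported on a face. The search stops because \<open>high_degree \<Delta> 0\<close> is
        everything.\<close>
      obtain r where r: "r < n" "p \<in> high_degree \<Delta> r" "p \<notin> high_degree \<Delta> (Suc r)"
        using notin
      proof (induction n arbitrary: thesis)
        case (Suc n)
        then show ?case by (metis less_SucI lessI)
      qed simp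
      have hd: "ideal (high_degree \<Delta> k :: ('v, 'k) mpoly set) mpoly_ring" for k
        by (rule ideal_high_degree[OF \<Delta>])
      have "?t i \<in> high_degree \<Delta> (Suc (r * N))" if i: "i \<in> {1..N}" for i
      proof -
        have "?t i \<in> high_degree \<Delta> (n * i + r * (N - i))"
          using i by (intro high_degree_mult high_degree_power \<Delta> q r) auto
        \<comment> \<open>Trading \<open>i\<close> contributions \<open>r\<close> for
          \<open>n > r\<close> gains at least \<open>i \<ge> 1\<close>.\<close>
        moreover have "Suc (r * N) \<le> n * i + r * (N - i)"
        proof -
          have "r * N + i = Suc r * i + r * (N - i)"
            using i by (simp add: algebra_simps flip: distrib_left)
          moreover have "Suc r * i \<le> n * i" using r(1) by (intro mult_right_mono) auto
          ultimately show ?thesis using i by auto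
        qed
        ultimately show ?thesis using high_degree_antimono by blast
      qed
      then have "(\<Sum>i\<in>{1..N}. ?t i) \<in> high_degree \<Delta> (Suc (r * N))"
        unfolding high_degree_def by (simp add: avoiding_iff lookup_sum)
      then have "(\<Sum>i\<le>N. ?t i) + - (\<Sum>i\<in>{1..N}. ?t i) \<in> high_degree \<Delta> (Suc (r * N))"
        using sum_mem unfolding high_degree_def by (intro add_avoiding uminus_avoiding)
      then have "p ^ N \<in> high_degree \<Delta> (Suc (r * N))"
        unfolding sum_split by simp
      with power_notin_high_degree[OF \<Delta> r(2,3)] show False by blast
    qed
    then show "x \<in> ?K" by (simp add: p)
  qed
qed

section \<open>Lengths as numbers of monomials\<close>

lemma finite_total_degree_less: "finite {m :: 'v::finite \<Rightarrow>\<^sub>0 nat. total_degree m < n}"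
proof (rule finite_imageD)
  show "inj_on lookup {m :: 'v \<Rightarrow>\<^sub>0 nat. total_degree m < n}"
    by (simp add: inj_on_def poly_mapping.lookup_inject)
  have "lookup ` {m :: 'v \<Rightarrow>\<^sub>0 nat. total_degree m < n} \<subseteq> PiE UNIV (\<lambda>_. {..n})"
    using le_trans[OF lookup_le_total_degree less_imp_le] by auto
  then show "finite (lookup ` {m :: 'v \<Rightarrow>\<^sub>0 nat. total_degree m < n})"
    by (rule finite_subset) (simp add: finite_PiE)
qed

lemma quotient_length_high_degree:
  fixes \<Delta> :: "'v::finite set set"
  assumes \<Delta>: "simplicial_complex \<Delta>"
  shows "quotient_length (face_ring \<Delta>) (face_proj \<Delta> ` (high_degree \<Delta> n :: ('v, 'k::field) mpoly set))
    = enat (card {m :: 'v \<Rightarrow>\<^sub>0 nat. keys m \<in> \<Delta> \<and> total_degree m < n})"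
proof (rule quotient_length_eq_card[OF face_proj_hom carrier_face_ring[symmetric] cring_face_ring
      ideal_face_proj_image[OF ideal_high_degree[OF \<Delta>]]])
  show "face_proj \<Delta> -` face_proj \<Delta> ` high_degree \<Delta> n
      = (avoiding {m. keys m \<in> \<Delta> \<and> total_degree m < n} :: ('v, 'k) mpoly set)"
    using face_proj_vimage_image[OF ideal_high_degree[OF \<Delta>] stanley_reisner_subset_high_degree[OF \<Delta>]]
    by (simp add: high_degree_def)
  show "divisor_closed {m :: 'v \<Rightarrow>\<^sub>0 nat. keys m \<in> \<Delta> \<and> total_degree m < n}"
    by (rule divisor_closed_supports[OF \<Delta>])
  show "finite {m :: 'v \<Rightarrow>\<^sub>0 nat. keys m \<in> \<Delta> \<and> total_degree m < n}"
    by (rule rev_finite_subset[OF finite_total_degree_less[of n]]) auto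
qed

section \<open>Hilbert polynomials\<close>

text \<open>Pascal's rule: for \<open>v\<close> in \<open>F\<close>, dividing by the variable of
  \<open>v\<close> lowers the degree by one and leaves support \<open>F\<close> or
  \<open>F - {v}\<close>.\<close>

lemma card_exponents_with_support:
  fixes F :: "'v::finite set"
  shows "card {m :: 'v \<Rightarrow>\<^sub>0 nat. keys m = F \<and> total_degree m \<le> n} = n choose card F"
proof (induction n arbitrary: F)
  case 0
  have "{m :: 'v \<Rightarrow>\<^sub>0 nat. keys m = F \<and> total_degree m \<le> 0} = (if F = {} then {0} else {})"
    by auto
  then show ?case by (auto simp: card_gt_0_iff binomial_eq_0)
next
  case (Suc n)
  show ?case
  proof (cases "F = {}")
    case True
    then have "{m :: 'v \<Rightarrow>\<^sub>0 nat. keys m = F \<and> total_degree m \<le> Suc n} = {0}"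
      by (auto simp: keys_eq_empty)
    then show ?thesis using True by simp
  next
    case False
    then obtain v where v: "v \<in> F" by auto
    let ?C = "\<lambda>F n. {m :: 'v \<Rightarrow>\<^sub>0 nat. keys m = F \<and> total_degree m \<le> n}"
    let ?e = "Poly_Mapping.single v (1::nat)"
    have fin: "finite (?C G k)" for G k
      by (rule finite_subset[OF _ finite_total_degree_less[of "Suc k"]]) auto
    have "?C F (Suc n) = (\<lambda>m. m + ?e) ` (?C F n \<union> ?C (F - {v}) n)"
    proof (rule equalityI; rule subsetI)
      fix m assume m: "m \<in> ?C F (Suc n)"
      define m' where "m' = m - ?e"
      have "v \<in> keys m" using v m by simp
      have m': "m = m' + ?e"
        using \<open>v \<in> keys m\<close> unfolding m'_def
        by (intro poly_mapping_eqI) (auto simp: lookup_add lookup_minus lookup_single when_def in_keys_iff)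
      have "keys m = insert v (keys m')" "total_degree m = Suc (total_degree m')"
        using arg_cong[OF m', of keys] arg_cong[OF m', of total_degree] by (simp_all add: keys_plus_nat)
      with m have F: "F = insert v (keys m')" and "total_degree m' \<le> n"
        by simp_all
      moreover have "keys m' = F \<or> keys m' = F - {v}"
        unfolding F by (cases "v \<in> keys m'") (simp_all add: insert_absorb)
      ultimately show "m \<in> (\<lambda>m. m + ?e) ` (?C F n \<union> ?C (F - {v}) n)"
        using m' by (intro image_eqI[of m _ m']) simp_all
    next
      fix m assume "m \<in> (\<lambda>m. m + ?e) ` (?C F n \<union> ?C (F - {v}) n)"
      then obtain m' where m': "m = m' + ?e" "keys m' = F \<or> keys m' = F - {v}" "total_degree m' \<le> n"
        by blast
      have "keys m = insert v (keys m')"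
        unfolding m'(1) keys_plus_nat by simp
      also have "\<dots> = F"
        using m'(2) v by (metis insert_absorb insert_Diff)
      finally show "m \<in> ?C F (Suc n)"
        using m'(3) unfolding m'(1) mem_Collect_eq total_degree_add total_degree_single by simp
    qed
    then have "card (?C F (Suc n)) = card (?C F n \<union> ?C (F - {v}) n)"
      by (simp add: card_image)
    also have "\<dots> = card (?C F n) + card (?C (F - {v}) n)"
      using v by (intro card_Un_disjoint fin) auto
    also have "\<dots> = Suc n choose card F"
      using v Suc by (cases "card F") (auto simp: card_Diff_singleton)
    finally show ?thesis .
  qed
qed

text \<open>Sort the monomials by their support.\<close>

lemma card_exponents_in_complex:
  fixes \<Delta> :: "'v::finite set set"
  shows "card {m :: 'v \<Rightarrow>\<^sub>0 nat. keys m \<in> \<Delta> \<and> total_degree m < n + 1} = (\<Sum>F\<in>\<Delta>. n choose card F)"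
proof -
  have "{m :: 'v \<Rightarrow>\<^sub>0 nat. keys m \<in> \<Delta> \<and> total_degree m < n + 1}
      = (\<Union>F\<in>\<Delta>. {m. keys m = F \<and> total_degree m \<le> n})"
    by auto
  moreover have "finite {m :: 'v \<Rightarrow>\<^sub>0 nat. keys m = F \<and> total_degree m \<le> n}" for F
    by (rule finite_subset[OF _ finite_total_degree_less[of "Suc n"]]) auto
  ultimately show ?thesis
    by (auto simp: card_exponents_with_support intro!: trans[OF card_UN_disjoint])
qed

section \<open>Binomial polynomials and uniqueness of the coefficients\<close>

text \<open>The product form exposes the degree and the leading coefficient.\<close>

definition choose_poly :: "nat \<Rightarrow> rat poly" where
  "choose_poly k = smult (1 / fact k) (\<Prod>i<k. [:- of_nat i, 1:])"

lemma poly_choose_poly [simp]: "poly (choose_poly k) x = x gchoose k"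
  by (simp add: choose_poly_def poly_prod gbinomial_prod_rev atLeast0LessThan)

lemma degree_choose_poly [simp]: "degree (choose_poly k) = k"
  by (simp add: choose_poly_def degree_prod_eq_sum_degree)

lemma lead_coeff_choose_poly [simp]: "coeff (choose_poly k) k = 1 / fact k"
proof -
  have "coeff (choose_poly k) k = lead_coeff (choose_poly k)" by simp
  also have "\<dots> = 1 / fact k"
    unfolding choose_poly_def lead_coeff_smult lead_coeff_prod by simp
  finally show ?thesis .
qed

text \<open>Polynomials that agree at infinitely many naturals are equal, so the definite
  description has only one candidate.\<close>

lemma eventual_poly_eq:
  fixes Q :: "rat poly"
  assumes "\<And>n. \<exists>l. h n = enat l \<and> poly Q (of_nat n) = of_nat l"
  shows "eventual_poly h = Q"
  unfolding eventual_poly_def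
proof (rule the_equality)
  show "\<forall>\<^sub>F n in sequentially. \<exists>l. h n = enat l \<and> poly Q (of_nat n) = of_nat l"
    using assms by simp
  fix P :: "rat poly" assume "\<forall>\<^sub>F n in sequentially. \<exists>l. h n = enat l \<and> poly P (of_nat n) = of_nat l"
  then obtain N where N: "\<And>n. n \<ge> N \<Longrightarrow> \<exists>l. h n = enat l \<and> poly P (of_nat n) = of_nat l"
    by (auto simp: eventually_sequentially)
  have "poly (P - Q) (of_nat n) = 0" if "n \<ge> N" for n
    using N[OF that] assms[of n] by auto
  then have "of_nat ` {N..} \<subseteq> {x. poly (P - Q) x = 0}" by auto
  moreover have "infinite (of_nat ` {N..} :: rat set)"
    by (simp add: finite_image_iff inj_on_def infinite_Ici)
  ultimately have "P - Q = 0"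
    using poly_roots_finite finite_subset by blast
  then show "P = Q" by simp
qed

text \<open>Upper negation turns the value into an ordinary binomial coefficient of
  \<open>t\<close>, which vanishes for \<open>m > t\<close>.\<close>

lemma gchoose_shift_at_negative:
  "((- of_nat (Suc t) + of_nat m) gchoose m) = (if t < m then 0 else (-1) ^ m * of_nat (t choose m) :: rat)"
proof -
  have "((- of_nat (Suc t) + of_nat m) gchoose m) = (-1) ^ m * ((of_nat t :: rat) gchoose m)"
    by (subst gbinomial_negated_upper) (simp add: algebra_simps)
  then show ?thesis by (simp add: binomial_gbinomial[symmetric] binomial_eq_0)
qed

text \<open>Evaluation at \<open>-1, -2, -3, \<dots>\<close> makes the system triangular.\<close>

lemma shifted_binomials_independent:
  fixes b :: "nat \<Rightarrow> rat"
  assumes "\<And>x. (\<Sum>m\<le>D. b m * ((x + of_nat m) gchoose m)) = 0" and "t \<le> D"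
  shows "b t = 0"
  using \<open>t \<le> D\<close>
proof (induction t rule: less_induct)
  case (less t)
  have "0 = (\<Sum>m\<le>D. b m * ((- of_nat (Suc t) + of_nat m) gchoose m))"
    using assms(1) by simp
  also have "\<dots> = (\<Sum>m\<le>D. if m = t then b t * (-1) ^ t else 0)"
    unfolding gchoose_shift_at_negative
    by (rule sum.cong) (use less in \<open>auto simp: not_less le_less\<close>)
  also have "\<dots> = b t * (-1) ^ t" using less.prems by simp
  finally show ?case by simp
qed

text \<open>Independence of the shifted binomials makes the coefficients unique. The bound on
  \<open>i\<close> matters: beyond the degree, \<open>e i\<close> is unconstrained in the
  description.\<close>

lemma binomial_basis_coeff_eq:
  assumes Q: "\<And>x. poly Q x = (\<Sum>m\<le>degree Q. b m * ((x + of_nat m) gchoose m))" and "i \<le> degree Q"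
  shows "binomial_basis_coeff Q i = (-1) ^ i * b (degree Q - i)"
proof -
  let ?D = "degree Q"
  \<comment> \<open>Reindexing by \<open>m = ?D - j\<close> passes from the descending convention to
    the ascending one of \<open>b\<close>.\<close>
  have rev: "(\<Sum>j\<le>?D. (-1) ^ j * e j * ((x + of_nat (?D - j)) gchoose (?D - j)))
    = (\<Sum>m\<le>?D. ((-1) ^ (?D - m) * e (?D - m)) * ((x + of_nat m) gchoose m))" for e and x :: rat
    by (rule sum.reindex_bij_witness[of _ "\<lambda>m. ?D - m" "\<lambda>m. ?D - m"]) auto
  show ?thesis
    unfolding binomial_basis_coeff_def rev
  proof (rule the_equality)
    show "\<exists>e. e i = (-1) ^ i * b (?D - i) \<and>
       (\<forall>x. poly Q x = (\<Sum>m\<le>?D. ((-1) ^ (?D - m) * e (?D - m)) * ((x + of_nat m) gchoose m)))"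
      by (rule exI[of _ "\<lambda>j. (-1) ^ j * b (?D - j)"]) (auto simp: Q intro!: sum.cong)
    fix c assume "\<exists>e. e i = c \<and>
       (\<forall>x. poly Q x = (\<Sum>m\<le>?D. ((-1) ^ (?D - m) * e (?D - m)) * ((x + of_nat m) gchoose m)))"
    then obtain e where e: "e i = c"
      "\<And>x. poly Q x = (\<Sum>m\<le>?D. ((-1) ^ (?D - m) * e (?D - m)) * ((x + of_nat m) gchoose m))" by blast
    have "(-1) ^ (?D - m) * e (?D - m) - b m = 0" if "m \<le> ?D" for m
      using e(2) Q that
      by (intro shifted_binomials_independent[where D = ?D and b = "\<lambda>m. (-1) ^ (?D - m) * e (?D - m) - b m"])
         (auto simp: left_diff_distrib sum_subtractf)
    from this[of "?D - i"] \<open>i \<le> ?D\<close> have "(-1) ^ i * c = b (?D - i)" using e(1) by simp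
    then show "c = (-1) ^ i * b (?D - i)" by (metis left_minus_one_mult_self)
  qed
qed

text \<open>Negate the upper index, split \<open>- x - 1 + k\<close> by Vandermonde, and negate back
  in each term.\<close>

lemma gchoose_shifted_expansion:
  fixes x :: rat
  assumes "k \<le> D"
  shows "x gchoose k = (\<Sum>m\<le>D. (-1) ^ (k + m) * of_nat (k choose m) * ((x + of_nat m) gchoose m))"
proof -
  have "x gchoose k = (-1) ^ k * ((- x - 1 + of_nat k) gchoose k)"
    by (subst gbinomial_negated_upper) (simp add: algebra_simps)
  also have "\<dots> = (-1) ^ k * (\<Sum>m\<le>k. ((- x - 1) gchoose m) * (of_nat k gchoose (k - m)))"
    by (simp add: gbinomial_Vandermonde atMost_atLeast0)
  also have "\<dots> = (\<Sum>m\<le>k. (-1) ^ (k + m) * of_nat (k choose m) * ((x + of_nat m) gchoose m))"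
    unfolding sum_distrib_left
  proof (rule sum.cong)
    fix m assume "m \<in> {..k}"
    then have "(of_nat k gchoose (k - m) :: rat) = of_nat (k choose m)"
      by (simp add: binomial_gbinomial[symmetric] binomial_symmetric[of m k])
    moreover have "(- x - 1) gchoose m = (-1) ^ m * ((x + of_nat m) gchoose m)"
      by (subst gbinomial_negated_upper) (simp add: algebra_simps)
    ultimately show "(-1) ^ k * (((- x - 1) gchoose m) * (of_nat k gchoose (k - m)))
        = (-1) ^ (k + m) * of_nat (k choose m) * ((x + of_nat m) gchoose m)"
      by (simp add: power_add)
  qed simp
  \<comment> \<open>The added terms vanish; the common range \<open>D\<close> lets expansions for
    different \<open>k\<close> be summed.\<close>
  also have "\<dots> = (\<Sum>m\<le>D. (-1) ^ (k + m) * of_nat (k choose m) * ((x + of_nat m) gchoose m))"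
    using assms by (intro sum.mono_neutral_left) (auto simp: binomial_eq_0)
  finally show ?thesis .
qed

text \<open>At index \<open>d - 1\<close> of the shifted basis, \<open>choose_poly k\<close>
  contributes \<open>- d\<close> for \<open>k = d\<close>, \<open>1\<close> for
  \<open>k = d - 1\<close> and \<open>0\<close> for smaller \<open>k\<close>. For a complex,
  \<open>S\<close> is the set of faces and \<open>c\<close> counts vertices.\<close>

lemma e1_sum_choose_poly:
  fixes S :: "'a set" and c :: "'a \<Rightarrow> nat"
  assumes fin: "finite S" and le: "\<And>s. s \<in> S \<Longrightarrow> c s \<le> d" and "d \<ge> 1" and top: "\<exists>s\<in>S. c s = d"
  shows "binomial_basis_coeff (\<Sum>s\<in>S. choose_poly (c s)) 1
    = of_nat (d * card {s\<in>S. c s = d}) - of_nat (card {s\<in>S. c s = d - 1})"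
proof -
  let ?Q = "\<Sum>s\<in>S. choose_poly (c s)"
  define b where "b m = (\<Sum>s\<in>S. (-1) ^ (c s + m) * of_nat (c s choose m) :: rat)" for m
  have deg: "degree ?Q = d"
  proof (rule antisym)
    show "degree ?Q \<le> d" using le by (intro degree_sum_le fin) auto
    have "coeff ?Q d = (\<Sum>s\<in>S. if c s = d then 1 / fact d else 0)"
      unfolding coeff_sum using le by (intro sum.cong) (auto simp: coeff_eq_0 le_neq_implies_less)
    also have "\<dots> = of_nat (card {s\<in>S. c s = d}) / fact d"
      using fin by (simp add: sum.If_cases Int_def)
    \<comment> \<open>All leading terms are positive, so nothing cancels in degree
      \<open>d\<close>.\<close>
    also have "\<dots> \<noteq> 0" using top fin by auto
    finally show "d \<le> degree ?Q" by (rule le_degree)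
  qed
  have expansion: "poly ?Q x = (\<Sum>m\<le>d. b m * ((x + of_nat m) gchoose m))" for x
  proof -
    have "poly ?Q x = (\<Sum>s\<in>S. x gchoose c s)" by (simp add: poly_sum)
    also have "\<dots> = (\<Sum>s\<in>S. \<Sum>m\<le>d. (-1) ^ (c s + m) * of_nat (c s choose m) * ((x + of_nat m) gchoose m))"
      using le by (intro sum.cong refl gchoose_shifted_expansion) auto
    also have "\<dots> = (\<Sum>m\<le>d. b m * ((x + of_nat m) gchoose m))"
      unfolding b_def sum_distrib_right by (rule sum.swap)
    finally show ?thesis .
  qed
  \<comment> \<open>The sign is the factor \<open>(-1) ^ 1\<close> in the convention for the first
    coefficient.\<close>
  have "binomial_basis_coeff ?Q 1 = - b (d - 1)"
    using binomial_basis_coeff_eq[of ?Q b 1] expansion \<open>d \<ge> 1\<close> unfolding deg by simp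
  also have "\<dots> = (\<Sum>s\<in>S. (if c s = d then of_nat d else 0) - (if c s = d - 1 then 1 else 0))"
    unfolding b_def sum_negf[symmetric]
  proof (rule sum.cong)
    fix s assume "s \<in> S"
    then consider "c s = d" | "c s = d - 1" | "c s < d - 1" using le[of s] by linarith
    then show "- ((-1) ^ (c s + (d - 1)) * of_nat (c s choose (d - 1)))
        = ((if c s = d then of_nat d else 0) - (if c s = d - 1 then 1 else 0) :: rat)"
    proof cases
      case 1
      obtain k where "d = Suc k" using \<open>d \<ge> 1\<close> by (cases d) auto
      with 1 show ?thesis by (simp add: power_add[symmetric] flip: mult_2)
    qed (use \<open>d \<ge> 1\<close> in \<open>auto simp: binomial_eq_0 simp flip: mult_2\<close>)
  qed simp
  also have "\<dots> = of_nat (d * card {s\<in>S. c s = d}) - of_nat (card {s\<in>S. c s = d - 1})"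
    using fin by (simp add: sum_subtractf sum.If_cases Int_def mult.commute)
  finally show ?thesis .
qed

section \<open>Facets and ridges of a pure complex\<close>

lemma face_card_le:
  assumes "complex_dim (\<Delta> :: 'v::finite set set) = int d - 1" "F \<in> \<Delta>"
  shows "card F \<le> d"
proof -
  have "face_dim F \<le> complex_dim \<Delta>"
    unfolding complex_dim_def using assms(2) by (intro Max_ge) auto
  with assms(1) show ?thesis by (simp add: face_dim_def)
qed

lemma face_card_attained:
  assumes "simplicial_complex \<Delta>" "complex_dim \<Delta> = int d - 1"
  obtains F where "F \<in> \<Delta>" "card F = d"
proof -
  have "Max (face_dim ` \<Delta>) \<in> face_dim ` \<Delta>"
    using assms(1) by (intro Max_in) (auto simp: simplicial_complex_def)
  with assms(2) that show thesis by (auto simp: complex_dim_def face_dim_def)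
qed

lemma facet_above:
  assumes "F \<in> (\<Delta> :: 'v::finite set set)"
  obtains G where "G \<in> facets \<Delta>" "F \<subseteq> G"
proof -
  obtain G where "G \<in> \<Delta>" "F \<subseteq> G" "\<And>H. H \<in> \<Delta> \<Longrightarrow> G \<subseteq> H \<Longrightarrow> G = H"
    using finite_has_maximal2[of \<Delta> F] assms by auto
  then show thesis by (intro that) (auto simp: facets_def)
qed

lemma pure_card_ridges_le:
  fixes \<Delta> :: "'v::finite set set"
  assumes \<Delta>: "simplicial_complex \<Delta>" and pure: "pure_complex \<Delta>" and "d \<ge> 1" and dim: "complex_dim \<Delta> = int d - 1"
  shows "card {F\<in>\<Delta>. card F = d - 1} \<le> d * card {F\<in>\<Delta>. card F = d}"
proof -
  obtain H where H: "H \<in> \<Delta>" "card H = d" by (rule face_card_attained[OF \<Delta> dim])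
  \<comment> \<open>A face with the largest number of vertices is a facet; purity then gives every
    facet \<open>d\<close> vertices.\<close>
  have "H = G" if "G \<in> \<Delta>" "H \<subseteq> G" for G
    using card_seteq[OF finite that(2)] face_card_le[OF dim that(1)] H(2) by simp
  with H(1) have "H \<in> facets \<Delta>"
    by (auto simp: facets_def)
  then have "face_dim G = face_dim H" if "G \<in> facets \<Delta>" for G
    using pure that unfolding pure_complex_def by blast
  then have facet_card: "card G = d" if "G \<in> facets \<Delta>" for G
    using that H(2) by (simp add: face_dim_def)
  \<comment> \<open>A facet above \<open>F\<close> has exactly one more vertex. Several
    \<open>G\<close> may yield the same \<open>F\<close>, so the count gives an upper bound.\<close>
  have "{F\<in>\<Delta>. card F = d - 1} \<subseteq> (\<Union>G\<in>{F\<in>\<Delta>. card F = d}. (\<lambda>v. G - {v}) ` G)"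
  proof
    fix F assume F: "F \<in> {F\<in>\<Delta>. card F = d - 1}"
    then have "F \<in> \<Delta>" by simp
    then obtain G where G: "G \<in> facets \<Delta>" "F \<subseteq> G" by (rule facet_above)
    then have "card G = d" "G \<in> \<Delta>" using facet_card by (auto simp: facets_def)
    have "card (G - F) = 1"
      using F \<open>card G = d\<close> \<open>d \<ge> 1\<close> card_Diff_subset[OF finite G(2)] by simp
    then obtain v where "G - F = {v}" by (auto simp: card_1_singleton_iff)
    then have "F = G - {v}" "v \<in> G" using G(2) by auto
    with \<open>card G = d\<close> \<open>G \<in> \<Delta>\<close> show "F \<in> (\<Union>G\<in>{F\<in>\<Delta>. card F = d}. (\<lambda>v. G - {v}) ` G)" by auto
  qed
  then have "card {F\<in>\<Delta>. card F = d - 1} \<le> card (\<Union>G\<in>{F\<in>\<Delta>. card F = d}. (\<lambda>v. G - {v}) ` G)"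
    by (intro card_mono) auto
  also have "\<dots> \<le> (\<Sum>G\<in>{F\<in>\<Delta>. card F = d}. card ((\<lambda>v. G - {v}) ` G))"
    by (rule card_UN_le) simp
  also have "\<dots> \<le> (\<Sum>G\<in>{F\<in>\<Delta>. card F = d}. d)"
    by (intro sum_mono) (auto intro: order.trans[OF card_image_le])
  finally show ?thesis by (simp add: mult.commute)
qed

theorem theorem2p3:
  fixes \<Delta> :: "'v::finite set set"
    and d :: nat
    and A :: "('v, 'k::field) mpoly set ring"
    and \<mm> :: "('v, 'k) mpoly set set"
  defines "A \<equiv> face_ring \<Delta>"
    and "\<mm> \<equiv> max_homogeneous_ideal \<Delta>"
  assumes "simplicial_complex \<Delta>"
    and "pure_complex \<Delta>"
    and "d \<ge> 1"
    and "complex_dim \<Delta> = int d - 1"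
  shows "normal_hilbert_coeff A \<mm> 1 = hilbert_coeff A \<mm> 1 \<and> hilbert_coeff A \<mm> 1 \<ge> 0"
proof
  note \<Delta> = \<open>simplicial_complex \<Delta>\<close> and dim = \<open>complex_dim \<Delta> = int d - 1\<close>
  \<comment> \<open>After rewriting, both sides are built from the same Hilbert function.\<close>
  show "normal_hilbert_coeff A \<mm> 1 = hilbert_coeff A \<mm> 1"
    unfolding normal_hilbert_coeff_def hilbert_coeff_def A_def \<mm>_def
      ideal_power_max_homogeneous_ideal[OF \<Delta>] ideal_integral_closure_high_degree[OF \<Delta>] ..
  \<comment> \<open>Each face \<open>F\<close> accounts for the monomials with support exactly
    \<open>F\<close>. This polynomial agrees with the Hilbert function at every \<open>n\<close>,
    already from \<open>n = 0\<close> on.\<close>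
  let ?Q = "\<Sum>F\<in>\<Delta>. choose_poly (card F)"
  have "eventual_poly (\<lambda>n. quotient_length A (ideal_power A \<mm> (n + 1))) = ?Q"
    unfolding A_def \<mm>_def ideal_power_max_homogeneous_ideal[OF \<Delta>] quotient_length_high_degree[OF \<Delta>]
      card_exponents_in_complex
    by (rule eventual_poly_eq) (simp add: poly_sum binomial_gbinomial)
  then have "hilbert_coeff A \<mm> 1 = binomial_basis_coeff ?Q 1"
    by (simp add: hilbert_coeff_def)
  also have "\<dots> = of_nat (d * card {F\<in>\<Delta>. card F = d}) - of_nat (card {F\<in>\<Delta>. card F = d - 1})"
    using face_card_le[OF dim] \<open>d \<ge> 1\<close> face_card_attained[OF \<Delta> dim]
    by (intro e1_sum_choose_poly) auto
  also have "\<dots> \<ge> 0"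
    using pure_card_ridges_le[OF \<Delta> \<open>pure_complex \<Delta>\<close> \<open>d \<ge> 1\<close> dim]
    by (simp only: diff_ge_0_iff_ge of_nat_le_iff)
  finally show "hilbert_coeff A \<mm> 1 \<ge> 0" .
qed

end
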